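(* For any $\alpha\in[1,\infty)$, and for all $\varepsilon\in(0,1)$ and $d\in\mathbb{N}$, we have $$N_{\psi_\alpha}(\varepsilon,d)\le\left\lceil C_\alpha\,d^{\max\{1,2/\alpha\}}\,(\log(d+1))^{2/\alpha}\,\varepsilon^{-2}\right\rceil,$$ where $$C_\alpha=2601\cdot\alpha^{2/\alpha}\cdot\left(\frac{\sqrt{2\pi}}{\mathrm{e}^{11/12}}\right)^{2/\alpha}.$$ In particular, the $d$-exponent of polynomial tractability of the discrepancy with respect to $\|\cdot\|_{\psi_\alpha}$ is at most $\max\{1,2/\alpha\}$.
   Context: Throughout, $\log$ is the natural logarithm, $\lceil x\rceil=\min\{n\in\mathbb{Z}:n\ge x\}$, and $\mathrm{Vol}$ is $d$-dimensional Lebesgue measure. Local discrepancy. For an $N$-element point set $\mathcal{P}=\{\boldsymbol{x}_1,\ldots,\boldsymbol{x}_N\}\subseteq[0,1]^d$, the local discrepancy function $\Delta_{\mathcal{P}}:[0,1]^d\to\mathbb{R}$ is $$\Delta_{\mathcal{P}}(\boldsymbol{t})=\frac{\#\{j\in\{1,\ldots,N\}:\boldsymbol{x}_j\in[\boldsymbol{0},\boldsymbol{t})\}}{N}-\mathrm{Vol}([\boldsymbol{0},\boldsymbol{t}]),$$ where $[\boldsymbol{0},\boldsymbol{t})=[0,t_1)\times\cdots\times[0,t_d)$ for $\boldsymbol{t}=(t_1,\ldots,t_d)$. For the empty point set, $\Delta_\emptyset(\boldsymbol{t})=-\mathrm{Vol}([\boldsymbol{0},\boldsymbol{t}])=-t_1\cdots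 t_d$. Exponential Orlicz norm. For $\alpha\in[1,\infty)$ let $\psi_\alpha(x)=\exp(x^\alpha)-1$ for $x\ge0$, and for measurable $f$ on $[0,1]^d$ let $$\|f\|_{\psi_\alpha}=\inf\left\{K>0:\int_{[0,1]^d}\psi_\alpha\left(\frac{|f(\boldsymbol{x})|}{K}\right)\mathrm{d}\boldsymbol{x}\le1\right\}.$$ Minimal discrepancy and its inverse. Set $$\mathrm{disc}_{\psi_\alpha}(N,d)=\inf_{\mathcal{P}\subseteq[0,1]^d,\ |\mathcal{P}|=N}\|\Delta_{\mathcal{P}}\|_{\psi_\alpha},$$ and, for $\varepsilon\in(0,1)$ and $d\in\mathbb{N}$, $$N_{\psi_\alpha}(\varepsilon,d)=\min\{N\in\mathbb{N}:\mathrm{disc}_{\psi_\alpha}(N,d)\le\varepsilon\,\|\Delta_\emptyset\|_{\psi_\alpha}\}.$$ Tractability. The discrepancy with respect to $\|\cdot\|_{\psi_\alpha}$ is polynomially tractable if there are numbers $C,\tau,\sigma\in(0,\infty)$ such that $N_{\psi_\alpha}(\varepsilon,d)\le C\,d^\tau\varepsilon^{-\sigma}$ for all $\varepsilon\in(0,1)$ and all $d\in\mathbb{N}$. The infimum over all exponents $\tau\in(0,\infty)$ for which a bound of this form holds (for some $C,\sigma\in(0,\infty)$) is called the $d$-exponent of polynomial tractability. *)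

theory Defs
  imports "HOL-Analysis.Analysis"
begin

text \<open>The dimension is quantified inside the tractability notions, so points of
  d-dimensional space are functions in the extensional product over the index set \<open>{..<d}\<close>.\<close>

definition lebesgue_dim :: "nat \<Rightarrow> (nat \<Rightarrow> real) measure" where
  "lebesgue_dim d = Pi\<^sub>M {..<d} (\<lambda>_. lborel)"

definition unit_cube :: "nat \<Rightarrow> (nat \<Rightarrow> real) set" where
  "unit_cube d = Pi\<^sub>E {..<d} (\<lambda>_. {0..1})"

definition half_open_box :: "nat \<Rightarrow> (nat \<Rightarrow> real) \<Rightarrow> (nat \<Rightarrow> real) set" where
  "half_open_box d t = Pi\<^sub>E {..<d} (\<lambda>i. {0..<t i})"

definition closed_box :: "nat \<Rightarrow> (nat \<Rightarrow> real) \<Rightarrow> (nat \<Rightarrow> real) set" where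
  "closed_box d t = Pi\<^sub>E {..<d} (\<lambda>i. {0..t i})"

text \<open>For the empty point set the first summand is \<open>0 / 0 = 0\<close>, which leaves minus the
  volume, as intended; see \<open>local_discrepancy_empty\<close> below.\<close>

definition local_discrepancy :: "nat \<Rightarrow> (nat \<Rightarrow> real) set \<Rightarrow> (nat \<Rightarrow> real) \<Rightarrow> real" where
  "local_discrepancy d P t =
     real (card {x \<in> P. x \<in> half_open_box d t}) / real (card P)
     - measure (lebesgue_dim d) (closed_box d t)"

definition psi :: "real \<Rightarrow> real \<Rightarrow> real" where
  "psi \<alpha> x = exp (x powr \<alpha>) - 1"

text \<open>The norm takes values in the extended nonnegative reals; it is \<open>\<infinity>\<close> if no admissible
  \<open>K\<close> exists.\<close>

definition orlicz_norm :: "real \<Rightarrow> nat \<Rightarrow> ((nat \<Rightarrow> real) \<Rightarrow> real) \<Rightarrow> ennreal" where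
  "orlicz_norm \<alpha> d f =
     Inf (ennreal ` {K. K > 0 \<and>
       (\<integral>\<^sup>+ x \<in> unit_cube d. ennreal (psi \<alpha> (\<bar>f x\<bar> / K)) \<partial>lebesgue_dim d) \<le> 1})"

definition min_disc :: "real \<Rightarrow> nat \<Rightarrow> nat \<Rightarrow> ennreal" where
  "min_disc \<alpha> N d =
     (INF P \<in> {P. finite P \<and> P \<subseteq> unit_cube d \<and> card P = N}.
        orlicz_norm \<alpha> d (local_discrepancy d P))"

text \<open>An infimum in \<^typ>\<open>enat\<close> is attained if the set is nonempty, and is \<open>\<infinity>\<close> otherwise.\<close>

definition inv_disc :: "real \<Rightarrow> real \<Rightarrow> nat \<Rightarrow> enat" where
  "inv_disc \<alpha> \<epsilon> d =
     Inf (enat ` {N. N \<ge> 1 \<and>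
       min_disc \<alpha> N d \<le> ennreal \<epsilon> * orlicz_norm \<alpha> d (local_discrepancy d {})})"

definition tractability_bound :: "real \<Rightarrow> real \<Rightarrow> real \<Rightarrow> real \<Rightarrow> bool" where
  "tractability_bound \<alpha> C \<tau> \<sigma> \<longleftrightarrow>
     (\<forall>\<epsilon> d. 0 < \<epsilon> \<longrightarrow> \<epsilon> < 1 \<longrightarrow> d \<ge> 1 \<longrightarrow>
        ereal_of_enat (inv_disc \<alpha> \<epsilon> d) \<le> ereal (C * real d powr \<tau> * \<epsilon> powr (- \<sigma>)))"

definition polynomially_tractable :: "real \<Rightarrow> bool" where
  "polynomially_tractable \<alpha> \<longleftrightarrow>
     (\<exists>C>0. \<exists>\<tau>>0. \<exists>\<sigma>>0. tractability_bound \<alpha> C \<tau> \<sigma>)"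

text \<open>The infimum is taken in the extended reals, so it is \<open>\<infinity>\<close> without tractability.\<close>

definition d_exponent :: "real \<Rightarrow> ereal" where
  "d_exponent \<alpha> =
     Inf (ereal ` {\<tau>. \<tau> > 0 \<and> (\<exists>C>0. \<exists>\<sigma>>0. tractability_bound \<alpha> C \<tau> \<sigma>)})"

definition tractability_const :: "real \<Rightarrow> real" where
  "tractability_const \<alpha> =
     2601 * \<alpha> powr (2 / \<alpha>) * (sqrt (2 * pi) / exp (11 / 12)) powr (2 / \<alpha>)"

lemma measure_closed_box:
  assumes "\<And>i. i < d \<Longrightarrow> 0 \<le> t i"
  shows "measure (lebesgue_dim d) (closed_box d t) = (\<Prod>i<d. t i)"
proof -
  interpret product_sigma_finite "\<lambda>_::nat. lborel :: real measure"
    by standard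
  have "emeasure (lebesgue_dim d) (closed_box d t) = (\<Prod>i<d. emeasure lborel {0..t i})"
    unfolding lebesgue_dim_def closed_box_def by (rule emeasure_PiM) auto
  also have "\<dots> = (\<Prod>i<d. ennreal (t i))"
    using assms by (intro prod.cong) auto
  also have "\<dots> = ennreal (\<Prod>i<d. t i)"
    using assms by (intro prod_ennreal) auto
  finally have "emeasure (lebesgue_dim d) (closed_box d t) = ennreal (\<Prod>i<d. t i)" .
  moreover have "0 \<le> (\<Prod>i<d. t i)"
    using assms by (intro prod_nonneg) auto
  ultimately show ?thesis
    by (simp add: measure_def)
qed

lemma local_discrepancy_empty:
  assumes "t \<in> unit_cube d"
  shows "local_discrepancy d {} t = - (\<Prod>i<d. t i)"
proof -
  have "0 \<le> t i" if "i < d" for i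
    using assms that by (auto simp: unit_cube_def PiE_iff)
  then show ?thesis
    by (simp add: local_discrepancy_def measure_closed_box)
qed

end

theory Submission
  imports Defs "HOL-Probability.Infinite_Product_Measure"
begin

text \<open>The proof is probabilistic. For \<open>N\<close> independent uniform points, the discrepancy \<open>\<Delta>\<close> at
  a fixed \<open>t\<close> is an average of \<open>N\<close> centred Bernoulli variables, so it has Gaussian tails at scale
  \<open>N\<^sup>-\<^sup>1\<^sup>/\<^sup>2\<close>, whatever the dimension. Averaging \<open>exp (N \<Delta>(t)\<^sup>2 / 80) - 1\<close> over \<open>t\<close> as well
  (\<open>nn_integral_exp_sq_deviation_boxes_le\<close>), Markov's inequality shows that its integral over the
  cube is at most \<open>1/2\<close> with probability at least \<open>1/2\<close>. A dyadic chaining argument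
  (\<open>emeasure_chain_failure\<close>, \<open>deviation_corner_box_le\<close>) shows that the supremum of
  \<open>\<bar>\<Delta>\<bar>\<close> is at most \<open>51 sqrt (d / N)\<close> with probability greater than \<open>1/2\<close>. Since independent
  uniform points are almost surely distinct, some set of exactly \<open>N\<close> points has both properties
  (\<open>good_point_set_exists\<close>).

  For \<open>\<alpha> \<le> 2\<close> the square integral alone bounds the Orlicz norm by \<open>sqrt (80 / N)\<close>. For
  \<open>\<alpha> > 2\<close> one interpolates, \<open>\<bar>\<Delta>\<bar>\<^sup>\<alpha> \<le> \<Delta>\<^sup>2 (sup \<bar>\<Delta>\<bar>)\<^sup>\<alpha>\<^sup>-\<^sup>2\<close>, and this is where a factor
  \<open>d\<^sup>1\<^sup>/\<^sup>2\<^sup>-\<^sup>1\<^sup>/\<^sup>\<alpha>\<close> enters (\<open>min_disc_le\<close>). As \<open>\<alpha>\<close> grows, the theorem approaches the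
  statement that \<open>2601 d / \<epsilon>\<^sup>2 = 51\<^sup>2 d / \<epsilon>\<^sup>2\<close> points suffice for star discrepancy \<open>\<epsilon>\<close>; hence the
  chaining must not lose a logarithm of the dimension.

  The initial discrepancy is \<open>t\<^sub>1 \<cdots> t\<^sub>d\<close> in absolute value. It is at least \<open>exp (- 1 / \<alpha>)\<close> on the
  cube \<open>[exp (- 1 / (\<alpha> d)), 1]\<^sup>d\<close>, whose volume is at least \<open>(\<alpha> d + 1)\<^sup>-\<^sup>d\<close>, so its norm is at
  least \<open>(2 e \<alpha> d log (d + 1))\<^sup>-\<^sup>1\<^sup>/\<^sup>\<alpha>\<close> (\<open>orlicz_norm_empty_ge\<close>). Comparing the two
  norms gives the number of points. The logarithmic factor grows more slowly than every positive power of
  \<open>d\<close>, so every exponent above \<open>max 1 (2 / \<alpha>)\<close> is admissible for polynomial tractability.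

  In the chaining, boxes \<open>[0, a]\<close> with \<open>a\<^sub>i = exp (- n\<^sub>i / (2\<^sup>k d))\<close> approximate all anchored boxes
  at level \<open>k\<close>. On this logarithmic scale the volume is a function of \<open>\<Sum>i. n\<^sub>i\<close>, and moving
  every coordinate by one step changes the volume by a relative amount of about \<open>2\<^sup>-\<^sup>k\<close>. Only boxes
  of volume at least \<open>2\<^sup>-\<^sup>k\<close> are kept, so the grid is a set of lattice points in a
  simplex and has at most \<open>exp (d (k + 1))\<close> elements (\<open>card_grid_le\<close>), with no factor \<open>d\<^sup>d\<close>.
  Successive approximations differ by sets of measure \<open>O(2\<^sup>-\<^sup>k)\<close>, whose empirical measures
  fluctuate correspondingly less; the variance-sensitive tail bound \<open>emeasure_deviation_ge\<close>
  exploits this, and the union bounds over all levels sum to a geometric series.\<close>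

section \<open>Concentration of the empirical measure\<close>

lemma exp_le_quadratic:
  fixes x :: real
  assumes "\<bar>x\<bar> \<le> 1"
  shows "exp x \<le> 1 + x + x\<^sup>2"
proof (cases "0 \<le> x")
  case True
  then show ?thesis using assms by (intro exp_bound) auto
next
  case False
  have pos: "0 < 1 - x" using False by simp
  have "x ^ 3 \<le> 0" using False by (simp add: power_le_zero_eq)
  then have "1 \<le> (1 + x + x\<^sup>2) * (1 - x)"
    by (simp add: algebra_simps power2_eq_square power3_eq_cube)
  moreover have "exp x * (1 - x) \<le> exp x * exp (- x)"
    using exp_ge_add_one_self[of "- x"] by (intro mult_left_mono) auto
  then have "exp x * (1 - x) \<le> 1" by (simp flip: exp_add)
  ultimately have "exp x * (1 - x) \<le> (1 + x + x\<^sup>2) * (1 - x)" by linarith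
  then show ?thesis using pos by (simp only: mult_le_cancel_right_pos)
qed

text \<open>The deviation is not divided by \<open>N\<close>: for an anchored box it is \<open>N\<close> times the local discrepancy of the
  sample.\<close>

definition deviation :: "'a measure \<Rightarrow> nat \<Rightarrow> 'a set \<Rightarrow> (nat \<Rightarrow> 'a) \<Rightarrow> real" where
  "deviation M N A \<omega> = (\<Sum>i<N. indicator A (\<omega> i)) - real N * measure M A"

lemma deviation_measurable [measurable]:
  assumes [measurable]: "A \<in> sets M"
  shows "deviation M N A \<in> borel_measurable (Pi\<^sub>M {..<N} (\<lambda>_. M))"
  unfolding deviation_def[abs_def] by measurable

lemma abs_deviation_le:
  assumes "prob_space M"
  shows "\<bar>deviation M N A \<omega>\<bar> \<le> real N"
proof -
  interpret prob_space M by fact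
  have "(\<Sum>i<N. indicator A (\<omega> i)) \<le> (\<Sum>i<N. 1::real)"
    by (intro sum_mono) (auto simp: indicator_def)
  moreover have "0 \<le> (\<Sum>i<N. indicator A (\<omega> i) :: real)"
    by (intro sum_nonneg) auto
  moreover have "real N * measure M A \<le> real N * 1"
    by (intro mult_left_mono prob_le_1) auto
  moreover have "0 \<le> real N * measure M A" by simp
  ultimately show ?thesis unfolding deviation_def sum_constant card_lessThan mult_1_right
    by (intro abs_leI) linarith+
qed

lemma deviation_Diff:
  assumes "prob_space M" "A \<in> sets M" "B \<in> sets M" "B \<subseteq> A"
  shows "deviation M N (A - B) \<omega> = deviation M N A \<omega> - deviation M N B \<omega>"
proof -
  interpret prob_space M by fact
  have "indicator (A - B) x = (indicator A x - indicator B x :: real)" for x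
    using assms(4) by (auto simp: indicator_def)
  then have "(\<Sum>i<N. indicator (A - B) (\<omega> i) :: real)
      = (\<Sum>i<N. indicator A (\<omega> i)) - (\<Sum>i<N. indicator B (\<omega> i))"
    by (simp only: sum_subtractf)
  moreover have "measure M (A - B) = measure M A - measure M B"
    using assms by (intro finite_measure_Diff) auto
  ultimately show ?thesis
    by (simp only: deviation_def right_diff_distrib)
qed

text \<open>The bound on the moment generating function retains the measure of \<open>A\<close>; that is what makes small
  sets cheap in the chaining. The exponential factorises over the independent sample points, and one
  point contributes \<open>exp (- c p) (1 + (exp c - 1) p) \<le> exp (p c\<^sup>2)\<close>.\<close>

lemma nn_integral_exp_deviation_le:
  assumes "prob_space M" and A [measurable]: "A \<in> sets M" and "\<bar>c\<bar> \<le> 1"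
  shows "(\<integral>\<^sup>+\<omega>. ennreal (exp (c * deviation M N A \<omega>)) \<partial>Pi\<^sub>M {..<N} (\<lambda>_. M))
           \<le> ennreal (exp (real N * measure M A * c\<^sup>2))"
proof -
  interpret prob_space M by fact
  interpret product_sigma_finite "\<lambda>_::nat. M"
    by standard
  define p where "p = measure M A"
  have "p \<ge> 0" by (simp add: p_def)
  define g where "g x = exp (- c * p) * (1 + (exp c - 1) * indicator A x)" for x :: 'a
  have g_eq: "g x = exp (c * (indicator A x - p))" for x
    by (simp add: g_def indicator_def exp_diff exp_minus exp_add field_simps)
  have g_pos: "0 \<le> g x" for x by (simp add: g_eq)
  have int_g: "integrable M g"
    unfolding g_def[abs_def]
    by (intro integrable_mult_right Bochner_Integration.integrable_add integrable_const
        integrable_real_indicator) (auto simp: emeasure_eq_measure)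
  have "(\<integral>x. g x \<partial>M) = exp (- c * p) * (1 + (exp c - 1) * p)"
    unfolding g_def by (simp add: prob_space p_def emeasure_eq_measure)
  also have "\<dots> \<le> exp (- c * p) * exp ((c + c\<^sup>2) * p)"
  proof (intro mult_left_mono)
    have "1 + (exp c - 1) * p \<le> 1 + (c + c\<^sup>2) * p"
      using exp_le_quadratic[OF assms(3)] \<open>p \<ge> 0\<close> by (intro add_left_mono mult_right_mono) auto
    also have "\<dots> \<le> exp ((c + c\<^sup>2) * p)" by (rule exp_ge_add_one_self)
    finally show "1 + (exp c - 1) * p \<le> exp ((c + c\<^sup>2) * p)" .
  qed simp
  also have "\<dots> = exp (p * c\<^sup>2)"
    by (simp flip: exp_add add: algebra_simps)
  finally have g_le: "(\<integral>x. g x \<partial>M) \<le> exp (p * c\<^sup>2)" .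
  have "(\<integral>\<^sup>+\<omega>. ennreal (exp (c * deviation M N A \<omega>)) \<partial>Pi\<^sub>M {..<N} (\<lambda>_. M))
      = (\<integral>\<^sup>+\<omega>. (\<Prod>i<N. ennreal (g (\<omega> i))) \<partial>Pi\<^sub>M {..<N} (\<lambda>_. M))"
  proof (intro nn_integral_cong)
    fix \<omega>
    have "c * deviation M N A \<omega> = (\<Sum>i<N. c * (indicator A (\<omega> i) - p))"
      by (simp add: deviation_def p_def sum_subtractf sum_distrib_left algebra_simps)
    then show "ennreal (exp (c * deviation M N A \<omega>)) = (\<Prod>i<N. ennreal (g (\<omega> i)))"
      by (simp add: exp_sum g_eq prod_ennreal)
  qed
  also have "\<dots> = (\<Prod>i<N. \<integral>\<^sup>+x. ennreal (g x) \<partial>M)"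
    by (intro product_nn_integral_prod) (auto simp: g_def)
  also have "\<dots> = (\<Prod>i<N. ennreal (\<integral>x. g x \<partial>M))"
    using int_g g_pos by (simp add: nn_integral_eq_integral)
  also have "\<dots> \<le> (\<Prod>i<N. ennreal (exp (p * c\<^sup>2)))"
    using g_le by (intro prod_mono_ennreal ennreal_leI) auto
  also have "\<dots> = ennreal (exp (real N * p * c\<^sup>2))"
    by (simp add: ennreal_power exp_of_nat_mult mult.assoc)
  finally show ?thesis by (simp add: p_def)
qed

text \<open>Chernoff's bound, applied to both signs at once because \<open>exp (c \<bar>x\<bar>) \<le> exp (c x) + exp (- c x)\<close>.
  The optimal parameter is \<open>c = s / (2 N p)\<close>; it is left free because each application has its own
  reason why this value is at most 1.\<close>

lemma emeasure_deviation_ge: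
  assumes "prob_space M" and A [measurable]: "A \<in> sets M"
    and c: "0 \<le> c" "c \<le> 1" and p: "measure M A \<le> p"
  shows "emeasure (Pi\<^sub>M {..<N} (\<lambda>_. M)) {\<omega> \<in> space (Pi\<^sub>M {..<N} (\<lambda>_. M)). s \<le> \<bar>deviation M N A \<omega>\<bar>}
           \<le> ennreal (2 * exp (real N * p * c\<^sup>2 - c * s))"
proof -
  let ?P = "Pi\<^sub>M {..<N} (\<lambda>_. M)"
  let ?d = "deviation M N A"
  have "emeasure ?P {\<omega> \<in> space ?P. s \<le> \<bar>?d \<omega>\<bar>}
      = (\<integral>\<^sup>+\<omega>. indicator {\<omega> \<in> space ?P. s \<le> \<bar>?d \<omega>\<bar>} \<omega> \<partial>?P)"
    by (intro nn_integral_indicator[symmetric]) measurable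
  also have "\<dots> \<le> (\<integral>\<^sup>+\<omega>. ennreal (exp (- c * s)) *
      (ennreal (exp (c * ?d \<omega>)) + ennreal (exp (- c * ?d \<omega>))) \<partial>?P)"
  proof (intro nn_integral_mono)
    fix \<omega>
    show "indicator {\<omega> \<in> space ?P. s \<le> \<bar>?d \<omega>\<bar>} \<omega>
      \<le> ennreal (exp (- c * s)) * (ennreal (exp (c * ?d \<omega>)) + ennreal (exp (- c * ?d \<omega>)))"
    proof (cases "s \<le> \<bar>?d \<omega>\<bar>")
      case True
      have "c * s \<le> c * \<bar>?d \<omega>\<bar>" using True c by (intro mult_left_mono)
      then have "exp (c * s) \<le> exp (c * \<bar>?d \<omega>\<bar>)" by simp
      also have "\<dots> \<le> exp (c * ?d \<omega>) + exp (- c * ?d \<omega>)"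
        by (cases "0 \<le> ?d \<omega>") (auto simp: abs_if)
      finally have "exp (- c * s) * exp (c * s)
          \<le> exp (- c * s) * (exp (c * ?d \<omega>) + exp (- c * ?d \<omega>))"
        by (intro mult_left_mono) auto
      then have "1 \<le> exp (- c * s) * (exp (c * ?d \<omega>) + exp (- c * ?d \<omega>))"
        by (simp flip: exp_add)
      then have "ennreal 1 \<le> ennreal (exp (- c * s) * (exp (c * ?d \<omega>) + exp (- c * ?d \<omega>)))"
        by (rule ennreal_leI)
      also have "\<dots> = ennreal (exp (- c * s)) * (ennreal (exp (c * ?d \<omega>)) + ennreal (exp (- c * ?d \<omega>)))"
        by (simp add: ennreal_mult ennreal_plus)
      finally have "1 \<le> ennreal (exp (- c * s)) * (ennreal (exp (c * ?d \<omega>)) + ennreal (exp (- c * ?d \<omega>)))"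
        by simp
      then show ?thesis by (rule order_trans[rotated]) (simp add: indicator_def)
    qed (simp add: indicator_def)
  qed
  also have "\<dots> = ennreal (exp (- c * s)) *
      ((\<integral>\<^sup>+\<omega>. ennreal (exp (c * ?d \<omega>)) \<partial>?P) + (\<integral>\<^sup>+\<omega>. ennreal (exp (- c * ?d \<omega>)) \<partial>?P))"
    by (subst nn_integral_cmult, measurable, subst nn_integral_add) measurable
  also have "\<dots> \<le> ennreal (exp (- c * s)) *
      (ennreal (exp (real N * p * c\<^sup>2)) + ennreal (exp (real N * p * c\<^sup>2)))"
  proof (intro mult_left_mono add_mono)
    have "ennreal (exp (real N * measure M A * c\<^sup>2)) \<le> ennreal (exp (real N * p * c\<^sup>2))"
      using p by (intro ennreal_leI) (auto intro!: mult_right_mono mult_left_mono)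
    then show "(\<integral>\<^sup>+\<omega>. ennreal (exp (c * ?d \<omega>)) \<partial>?P) \<le> ennreal (exp (real N * p * c\<^sup>2))"
      and "(\<integral>\<^sup>+\<omega>. ennreal (exp (- c * ?d \<omega>)) \<partial>?P) \<le> ennreal (exp (real N * p * c\<^sup>2))"
      using nn_integral_exp_deviation_le[OF assms(1,2), of c N]
        nn_integral_exp_deviation_le[OF assms(1,2), of "- c" N] c by (auto intro: order_trans)
  qed auto
  also have "\<dots> = ennreal (exp (- c * s) * (exp (real N * p * c\<^sup>2) + exp (real N * p * c\<^sup>2)))"
    by (simp only: ennreal_mult ennreal_plus exp_ge_zero add_nonneg_nonneg)
  also have "exp (- c * s) * (exp (real N * p * c\<^sup>2) + exp (real N * p * c\<^sup>2))
      = 2 * exp (real N * p * c\<^sup>2 - c * s)"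
    by (simp add: exp_diff exp_minus field_simps)
  finally show ?thesis .
qed

text \<open>A discrete layer-cake formula: it turns the expectation of an exponential into a finite sum of tail
  probabilities. The telescoping sum up to the integer part of \<open>x\<close> already dominates the left side.\<close>

lemma exp_le_step_sum:
  fixes a x :: real
  assumes "0 \<le> a" "0 \<le> x" "x \<le> real N"
  shows "exp (a * x) - 1 \<le> (\<Sum>j\<le>N. (exp a - 1) * exp (a * real j) * (if real j \<le> x then 1 else 0))"
proof -
  define J where "J = nat \<lfloor>x\<rfloor>"
  have J: "real J \<le> x" "x < real J + 1" using assms by (auto simp: J_def)
  have JN: "J \<le> N" using assms J by linarith
  have "exp (a * x) \<le> exp (a * real (Suc J))"
    using J assms by (auto intro!: mult_left_mono)
  then have "exp (a * x) - 1 \<le> exp (a * real (Suc J)) - exp (a * real 0)" by simp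
  also have "\<dots> = (\<Sum>j<Suc J. exp (a * real (Suc j)) - exp (a * real j))"
    by (rule sum_lessThan_telescope[symmetric])
  also have "\<dots> = (\<Sum>j\<le>J. (exp a - 1) * exp (a * real j))"
    unfolding lessThan_Suc_atMost
    by (intro sum.cong) (auto simp: algebra_simps exp_add)
  also have "\<dots> = (\<Sum>j\<le>J. (exp a - 1) * exp (a * real j) * (if real j \<le> x then 1 else 0))"
    using J by (intro sum.cong) auto
  also have "\<dots> \<le> (\<Sum>j\<le>N. (exp a - 1) * exp (a * real j) * (if real j \<le> x then 1 else 0))"
    using JN assms by (intro sum_mono2) auto
  finally show ?thesis .
qed

text \<open>With \<open>c = s / (2 N)\<close> the tail at \<open>s\<close> is at most \<open>2 exp (- s\<^sup>2 / (4 N))\<close>, and the constraint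
  \<open>c \<le> 1\<close> is harmless because the deviation never exceeds \<open>N\<close>. So \<open>x = deviation\<^sup>2 / (4 N)\<close> has an
  exponential tail, and the exponential moment of \<open>x / 20\<close> is a convergent geometric series.\<close>

lemma nn_integral_exp_sq_deviation_le:
  assumes "prob_space M" and A [measurable]: "A \<in> sets M" and N: "N \<ge> 1"
  shows "(\<integral>\<^sup>+\<omega>. ennreal (exp ((deviation M N A \<omega>)\<^sup>2 / (80 * real N)) - 1) \<partial>Pi\<^sub>M {..<N} (\<lambda>_. M))
           \<le> ennreal (1 / 4)"
proof -
  interpret prob_space M by fact
  let ?P = "Pi\<^sub>M {..<N} (\<lambda>_. M)"
  let ?d = "deviation M N A"
  define a :: real where "a = 1 / 20"
  define w where "w j = (exp a - 1) * exp (a * real j)" for j :: nat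
  define q where "q = exp (a - 1)"
  have a: "0 < a" by (simp add: a_def)
  have w_nonneg: "0 \<le> w j" for j using a by (simp add: w_def)
  \<comment> \<open>the event \<open>x \<ge> j\<close>, written so that the tail bound applies\<close>
  define E where "E j = {\<omega> \<in> space ?P. 2 * sqrt (real j * real N) \<le> \<bar>?d \<omega>\<bar>}" for j :: nat
  have E_sets [measurable]: "E j \<in> sets ?P" for j unfolding E_def by measurable
  have "(\<integral>\<^sup>+\<omega>. ennreal (exp ((?d \<omega>)\<^sup>2 / (80 * real N)) - 1) \<partial>?P)
      \<le> (\<integral>\<^sup>+\<omega>. (\<Sum>j\<le>N. ennreal (w j) * indicator (E j) \<omega>) \<partial>?P)"
  proof (intro nn_integral_mono)
    fix \<omega> assume \<omega>: "\<omega> \<in> space ?P"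
    define x where "x = (?d \<omega>)\<^sup>2 / (4 * real N)"
    have "(?d \<omega>)\<^sup>2 \<le> (real N)\<^sup>2"
      using abs_deviation_le[OF assms(1)] by (metis abs_le_square_iff abs_of_nat)
    then have "(?d \<omega>)\<^sup>2 \<le> 4 * (real N)\<^sup>2" by (smt (verit) zero_le_power2)
    then have x: "0 \<le> x" "x \<le> real N"
      using N by (auto simp: x_def divide_simps power2_eq_square)
    have ind: "(if real j \<le> x then 1 else 0) = (indicator (E j) \<omega> :: real)" for j
    proof -
      have "2 * sqrt (real j * real N) \<le> \<bar>?d \<omega>\<bar> \<longleftrightarrow> (2 * sqrt (real j * real N))\<^sup>2 \<le> (?d \<omega>)\<^sup>2"
        by (subst abs_le_square_iff[symmetric]) simp
      also have "\<dots> \<longleftrightarrow> real j \<le> x"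
        using N by (simp add: x_def power_mult_distrib field_simps)
      finally show ?thesis using \<omega> by (simp add: E_def indicator_def)
    qed
    have "exp ((?d \<omega>)\<^sup>2 / (80 * real N)) - 1 = exp (a * x) - 1"
      by (simp add: a_def x_def)
    also have "\<dots> \<le> (\<Sum>j\<le>N. w j * indicator (E j) \<omega>)"
      using exp_le_step_sum[of a x N] a x unfolding w_def ind by simp
    finally have "ennreal (exp ((?d \<omega>)\<^sup>2 / (80 * real N)) - 1)
        \<le> ennreal (\<Sum>j\<le>N. w j * indicator (E j) \<omega>)" by (rule ennreal_leI)
    also have "\<dots> = (\<Sum>j\<le>N. ennreal (w j * indicator (E j) \<omega>))"
      using w_nonneg by (intro sum_ennreal[symmetric]) auto
    also have "\<dots> = (\<Sum>j\<le>N. ennreal (w j) * indicator (E j) \<omega>)"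
      using w_nonneg by (intro sum.cong refl) (auto simp: indicator_def)
    finally show "ennreal (exp ((?d \<omega>)\<^sup>2 / (80 * real N)) - 1)
        \<le> (\<Sum>j\<le>N. ennreal (w j) * indicator (E j) \<omega>)" .
  qed
  also have "\<dots> = (\<Sum>j\<le>N. ennreal (w j) * emeasure ?P (E j))"
    by (subst nn_integral_sum) (auto simp: nn_integral_cmult_indicator simp del: sum_mult_indicator)
  also have "\<dots> \<le> (\<Sum>j\<le>N. ennreal (w j) * ennreal (2 * exp (- real j)))"
  proof (intro sum_mono mult_left_mono)
    fix j assume "j \<in> {..N}"
    then have j: "j \<le> N" by simp
    have rt: "sqrt (real j / real N) * sqrt (real j * real N) = real j"
      using N by (simp flip: real_sqrt_mult)
    \<comment> \<open>the optimal parameter for \<open>s = 2 sqrt (j N)\<close> is \<open>s / (2 N) = sqrt (j / N)\<close>, at most 1 as \<open>j \<le> N\<close>\<close>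
    have "emeasure ?P (E j) \<le> ennreal (2 * exp (real N * 1 * (sqrt (real j / real N))\<^sup>2
        - sqrt (real j / real N) * (2 * sqrt (real j * real N))))"
      unfolding E_def
      by (rule emeasure_deviation_ge) (use assms j in \<open>auto simp: real_sqrt_le_1_iff\<close>)
    also have "real N * 1 * (sqrt (real j / real N))\<^sup>2
        - sqrt (real j / real N) * (2 * sqrt (real j * real N)) = - real j"
      using rt N by simp
    finally show "emeasure ?P (E j) \<le> ennreal (2 * exp (- real j))" .
  qed auto
  also have "\<dots> = ennreal (\<Sum>j\<le>N. w j * (2 * exp (- real j)))"
    using w_nonneg by (subst sum_ennreal[symmetric]) (auto simp: ennreal_mult)
  also have "\<dots> \<le> ennreal (1 / 4)"
  proof (intro ennreal_leI)
    have q: "0 < q" "q < 1" by (auto simp: q_def a_def)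
    have "w j * (2 * exp (- real j)) = 2 * (exp a - 1) * q ^ j" for j
      by (simp add: w_def q_def exp_of_nat_mult[symmetric] exp_add[symmetric] algebra_simps)
    then have "(\<Sum>j\<le>N. w j * (2 * exp (- real j))) = 2 * (exp a - 1) * (\<Sum>j\<le>N. q ^ j)"
      by (simp add: sum_distrib_left)
    also have "(\<Sum>j\<le>N. q ^ j) = (1 - q ^ Suc N) / (1 - q)"
      using q by (simp add: sum_gp0)
    also have "2 * (exp a - 1) * \<dots> \<le> 2 * (21 / 400) * (1 / (1 - 20 / 39))"
    proof (intro mult_mono frac_le)
      \<comment> \<open>the product below is about 0.215, and the slack up to 1/4 absorbs these crude bounds\<close>
      show "exp a - 1 \<le> 21 / 400"
        using exp_bound[of a] by (simp add: a_def power2_eq_square)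
      have "39 / 20 \<le> exp (1 - a)"
        using exp_ge_add_one_self[of "1 - a"] by (simp add: a_def)
      moreover have "q = 1 / exp (1 - a)" by (simp add: q_def exp_diff)
      ultimately have "q \<le> 1 / (39 / 20)"
        by (simp only:) (intro divide_left_mono, auto)
      then show "1 - 20 / 39 \<le> 1 - q" by simp
      show "1 - q ^ Suc N \<le> 1" using q by simp
      show "0 \<le> (1 - q ^ Suc N) / (1 - q)"
        using q by (intro divide_nonneg_nonneg) (auto intro!: power_le_one mult_le_one)
    qed (use a q in auto)
    also have "\<dots> \<le> 1 / 4" by simp
    finally show "(\<Sum>j\<le>N. w j * (2 * exp (- real j))) \<le> 1 / 4" .
  qed
  finally show ?thesis .
qed

lemma deviation_mono:
  assumes "A \<subseteq> B"
  shows "deviation M N A \<omega> \<le> deviation M N B \<omega> + real N * (measure M B - measure M A)"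
proof -
  have "(\<Sum>i<N. indicator A (\<omega> i)) \<le> (\<Sum>i<N. indicator B (\<omega> i) :: real)"
    using assms by (intro sum_mono) (auto simp: indicator_def)
  then show ?thesis by (simp add: deviation_def algebra_simps)
qed

section \<open>Lebesgue measure on the unit cube\<close>

text \<open>Restricting the space, rather than the density, makes every point of a sample lie in the cube
  surely and not only almost surely.\<close>

definition cube_measure :: "nat \<Rightarrow> (nat \<Rightarrow> real) measure" where
  "cube_measure d = restrict_space (lebesgue_dim d) (unit_cube d)"

lemma box_in_sets_lebesgue_dim:
  "(\<And>i. i < d \<Longrightarrow> X i \<in> sets borel) \<Longrightarrow> Pi\<^sub>E {..<d} X \<in> sets (lebesgue_dim d)"
  unfolding lebesgue_dim_def by (intro sets_PiM_I_finite) auto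

lemma unit_cube_sets: "unit_cube d \<in> sets (lebesgue_dim d)"
  unfolding unit_cube_def by (intro box_in_sets_lebesgue_dim) auto

lemma space_cube_measure [simp]: "space (cube_measure d) = unit_cube d"
  using sets.sets_into_space[OF unit_cube_sets]
  by (auto simp: cube_measure_def space_restrict_space)

lemma emeasure_lebesgue_dim_box:
  assumes "\<And>i. i < d \<Longrightarrow> X i \<in> sets borel"
  shows "emeasure (lebesgue_dim d) (Pi\<^sub>E {..<d} X) = (\<Prod>i<d. emeasure lborel (X i))"
proof -
  interpret product_sigma_finite "\<lambda>_::nat. lborel :: real measure"
    by standard
  show ?thesis
    unfolding lebesgue_dim_def using assms by (intro emeasure_PiM) auto
qed

lemma emeasure_unit_cube: "emeasure (lebesgue_dim d) (unit_cube d) = 1"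
  unfolding unit_cube_def by (subst emeasure_lebesgue_dim_box) auto

lemma prob_space_cube_measure: "prob_space (cube_measure d)"
  using emeasure_unit_cube[of d] unit_cube_sets
  by (intro prob_spaceI)
    (simp add: cube_measure_def emeasure_restrict_space space_restrict_space2)

lemma in_sets_cube_measure:
  assumes "A \<in> sets (lebesgue_dim d)" "A \<subseteq> unit_cube d"
  shows "A \<in> sets (cube_measure d)"
  using assms unit_cube_sets by (simp add: cube_measure_def sets_restrict_space_iff sets.Int_space_eq2)

lemma emeasure_cube_measure:
  assumes "A \<subseteq> unit_cube d"
  shows "emeasure (cube_measure d) A = emeasure (lebesgue_dim d) A"
  using assms unit_cube_sets by (simp add: cube_measure_def emeasure_restrict_space)

lemma measure_cube_measure:
  assumes "A \<subseteq> unit_cube d"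
  shows "measure (cube_measure d) A = measure (lebesgue_dim d) A"
  using emeasure_cube_measure[OF assms] by (simp add: measure_def)

lemma nn_integral_cube_measure:
  "(\<integral>\<^sup>+x\<in>unit_cube d. f x \<partial>lebesgue_dim d) = (\<integral>\<^sup>+x. f x \<partial>cube_measure d)"
  unfolding cube_measure_def using unit_cube_sets by (subst nn_integral_restrict_space) auto

lemma closed_box_subset_unit_cube:
  assumes "\<And>i. i < d \<Longrightarrow> t i \<le> 1"
  shows "closed_box d t \<subseteq> unit_cube d"
  unfolding closed_box_def unit_cube_def using assms
  by (intro PiE_mono) (auto intro: order_trans)

lemma closed_box_sets:
  assumes "\<And>i. i < d \<Longrightarrow> t i \<le> 1"
  shows "closed_box d t \<in> sets (cube_measure d)"
  using closed_box_subset_unit_cube[OF assms]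
  by (intro in_sets_cube_measure) (auto simp: closed_box_def intro!: box_in_sets_lebesgue_dim)

lemma half_open_box_subset_unit_cube:
  assumes "t \<in> unit_cube d"
  shows "half_open_box d t \<subseteq> unit_cube d"
  unfolding half_open_box_def unit_cube_def
  proof (intro PiE_mono)
  fix i assume "i \<in> {..<d}"
  then have "t i \<le> 1" using assms by (auto simp: unit_cube_def PiE_iff)
  then show "{0..<t i} \<subseteq> {0..1}" by auto
qed

lemma half_open_box_sets:
  assumes "t \<in> unit_cube d"
  shows "half_open_box d t \<in> sets (cube_measure d)"
  using half_open_box_subset_unit_cube[OF assms]
  by (intro in_sets_cube_measure) (auto simp: half_open_box_def intro!: box_in_sets_lebesgue_dim)

lemma measure_half_open_box:
  assumes "t \<in> unit_cube d"
  shows "measure (cube_measure d) (half_open_box d t) = (\<Prod>i<d. t i)"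
proof -
  have t: "0 \<le> t i" if "i < d" for i
    using assms that by (auto simp: unit_cube_def PiE_iff)
  have "emeasure (lebesgue_dim d) (half_open_box d t) = (\<Prod>i<d. emeasure lborel {0..<t i})"
    unfolding half_open_box_def by (rule emeasure_lebesgue_dim_box) auto
  also have "\<dots> = (\<Prod>i<d. ennreal (t i))"
    using t by (intro prod.cong) auto
  also have "\<dots> = ennreal (\<Prod>i<d. t i)"
    using t by (intro prod_ennreal) auto
  finally have "emeasure (lebesgue_dim d) (half_open_box d t) = ennreal (\<Prod>i<d. t i)" .
  moreover have "0 \<le> (\<Prod>i<d. t i)"
    using t by (intro prod_nonneg) auto
  ultimately show ?thesis
    using half_open_box_subset_unit_cube[OF assms]
    by (simp add: measure_def emeasure_cube_measure)
qed

lemma component_measurable_cube_measure [measurable (raw)]: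
  assumes "l < d"
  shows "(\<lambda>x. x l) \<in> borel_measurable (cube_measure d)"
  unfolding cube_measure_def lebesgue_dim_def
  using assms by (intro measurable_restrict_space1) simp

lemma emeasure_cube_measure_singleton:
  assumes "d \<ge> 1" "x \<in> unit_cube d"
  shows "emeasure (cube_measure d) {x} = 0"
proof -
  have "{x} = Pi\<^sub>E {..<d} (\<lambda>i. {x i})"
    using assms(2) unfolding unit_cube_def by (intro PiE_singleton[symmetric]) (auto simp: PiE_def)
  then have "emeasure (lebesgue_dim d) {x} = (\<Prod>i<d. emeasure lborel {x i})"
    using emeasure_lebesgue_dim_box[of d "\<lambda>i. {x i}"] by simp
  also have "\<dots> = 0" using assms(1) by (simp add: power_0_left)
  finally show ?thesis using assms(2) by (simp add: emeasure_cube_measure)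
qed

section \<open>Uniform random points\<close>

text \<open>Distinctness matters because a point set is a set: coinciding sample points would give fewer than
  \<open>N\<close> elements and wrong multiplicities. By Fubini, given all other points, the \<open>i\<close>-th one hits the
  \<open>j\<close>-th with probability zero.\<close>

lemma AE_inj_on_PiM:
  fixes N :: nat
  assumes "prob_space M"
    and diag: "Measurable.pred (M \<Otimes>\<^sub>M M) (\<lambda>z. fst z = snd z)"
    and atom: "\<And>x. x \<in> space M \<Longrightarrow> emeasure M {x} = 0"
  shows "AE \<omega> in Pi\<^sub>M {..<N} (\<lambda>_. M). inj_on \<omega> {..<N}"
proof -
  interpret prob_space M by fact
  interpret product_sigma_finite "\<lambda>_::nat. M"
    by standard
  let ?P = "Pi\<^sub>M {..<N} (\<lambda>_. M)"
  have "AE \<omega> in ?P. \<omega> i \<noteq> \<omega> j" if ij: "i < N" "j < N" "i \<noteq> j" for i j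
  proof -
    define I where "I = {..<N} - {i}"
    have I: "finite I" "i \<notin> I" "insert i I = {..<N}" "j \<in> I" using ij by (auto simp: I_def)
    have comp: "(\<lambda>\<omega>. (\<omega> i, \<omega> j)) \<in> ?P \<rightarrow>\<^sub>M M \<Otimes>\<^sub>M M" using ij by (intro measurable_Pair measurable_component_singleton) auto
    have pr: "Measurable.pred ?P (\<lambda>\<omega>. \<omega> i = \<omega> j)"
      using measurable_compose[OF comp diag] by simp
    define F where "F = {\<omega> \<in> space ?P. \<omega> i = \<omega> j}"
    have F [measurable]: "F \<in> sets ?P" using pr by (simp add: F_def pred_def)
    have "emeasure ?P F = (\<integral>\<^sup>+\<omega>. indicator F \<omega> \<partial>Pi\<^sub>M (insert i I) (\<lambda>_. M))"
      by (simp add: I)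
    also have "\<dots> = (\<integral>\<^sup>+x. (\<integral>\<^sup>+y. indicator F (x(i := y)) \<partial>M) \<partial>Pi\<^sub>M I (\<lambda>_. M))"
      using I by (intro product_nn_integral_insert) auto
    also have "\<dots> = (\<integral>\<^sup>+x. 0 \<partial>Pi\<^sub>M I (\<lambda>_. M))"
    proof (intro nn_integral_cong)
      fix x assume "x \<in> space (Pi\<^sub>M I (\<lambda>_. M))"
      then have xj: "x j \<in> space M" using I by (auto simp: space_PiM)
      have "(\<integral>\<^sup>+y. indicator F (x(i := y)) \<partial>M) \<le> (\<integral>\<^sup>+y. indicator {x j} y \<partial>M)"
        using ij by (intro nn_integral_mono) (auto simp: indicator_def F_def)
      also have "\<dots> = 0"
      proof (cases "{x j} \<in> sets M")
        case True
        then show ?thesis using atom[OF xj] by simp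
      next
        case False
        have "(\<lambda>y. (y, x j)) \<in> M \<rightarrow>\<^sub>M M \<Otimes>\<^sub>M M" using xj by measurable
        from measurable_compose[OF this diag] have "Measurable.pred M (\<lambda>y. y = x j)" by simp
        then have "{y \<in> space M. y = x j} \<in> sets M" by (simp add: pred_def)
        moreover have "{y \<in> space M. y = x j} = {x j}" using xj by auto
        ultimately show ?thesis using False by simp
      qed
      finally show "(\<integral>\<^sup>+y. indicator F (x(i := y)) \<partial>M) = 0" by simp
    qed
    finally have "emeasure ?P F = 0" by simp
    then have "AE \<omega> in ?P. \<omega> \<notin> F" using F by (intro AE_not_in) (auto simp: null_sets_def)
    then show ?thesis by (rule AE_mp) (auto simp: F_def)
  qed
  then have "AE \<omega> in ?P. \<forall>i\<in>{..<N}. \<forall>j\<in>{..<N}. i \<noteq> j \<longrightarrow> \<omega> i \<noteq> \<omega> j"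
    by (intro AE_finite_allI) auto
  then show ?thesis by (rule AE_mp) (auto simp: inj_on_def)
qed

lemma AE_inj_on_cube_sample:
  fixes N :: nat
  assumes "d \<ge> 1"
  shows "AE \<omega> in Pi\<^sub>M {..<N} (\<lambda>_. cube_measure d). inj_on \<omega> {..<N}"
proof (rule AE_inj_on_PiM[OF prob_space_cube_measure])
  let ?M = "cube_measure d"
  have [measurable]: "Measurable.pred (?M \<Otimes>\<^sub>M ?M) (\<lambda>z. fst z l = snd z l)" if "l < d" for l
  proof -
    have [measurable]: "(\<lambda>z. fst z l) \<in> borel_measurable (?M \<Otimes>\<^sub>M ?M)"
        "(\<lambda>z. snd z l) \<in> borel_measurable (?M \<Otimes>\<^sub>M ?M)"
      using measurable_compose[OF measurable_fst component_measurable_cube_measure[OF that]]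
        measurable_compose[OF measurable_snd component_measurable_cube_measure[OF that]] by auto
    show ?thesis by measurable
  qed
  have all: "Measurable.pred (?M \<Otimes>\<^sub>M ?M) (\<lambda>z. \<forall>l\<in>{..<d}. fst z l = snd z l)"
    by (intro pred_intros_finite) auto
  have eq: "(\<forall>l\<in>{..<d}. fst z l = snd z l) = (fst z = snd z)" if "z \<in> space (?M \<Otimes>\<^sub>M ?M)" for z
  proof -
    have "fst z \<in> Pi\<^sub>E {..<d} (\<lambda>_. {0..1})" "snd z \<in> Pi\<^sub>E {..<d} (\<lambda>_. {0..1})"
      using that by (simp_all add: space_pair_measure mem_Times_iff unit_cube_def)
    then show ?thesis by (metis PiE_ext)
  qed
  show "Measurable.pred (?M \<Otimes>\<^sub>M ?M) (\<lambda>z. fst z = snd z)"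
    by (rule measurable_cong[THEN iffD1, OF _ all]) (rule eq)
qed (use assms emeasure_cube_measure_singleton in auto)

text \<open>Joint measurability in the sample and in the corner of the box, needed to exchange the two
  integrals; the deviation is rewritten through finitely many comparisons of coordinates.\<close>

lemma deviation_half_open_box_measurable:
  "(\<lambda>(\<omega>, t). deviation (cube_measure d) N (half_open_box d t) \<omega>)
     \<in> borel_measurable (Pi\<^sub>M {..<N} (\<lambda>_. cube_measure d) \<Otimes>\<^sub>M cube_measure d)"
proof -
  let ?M = "cube_measure d"
  let ?P = "Pi\<^sub>M {..<N} (\<lambda>_. ?M)"
  have t [measurable]: "(\<lambda>z. snd z l) \<in> borel_measurable (?P \<Otimes>\<^sub>M ?M)" if "l < d" for l
    using measurable_compose[OF measurable_snd component_measurable_cube_measure[OF that]] .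
  have w [measurable]: "(\<lambda>z. fst z i l) \<in> borel_measurable (?P \<Otimes>\<^sub>M ?M)" if "l < d" "i < N" for i l
  proof -
    have "(\<lambda>\<omega>. \<omega> i) \<in> ?P \<rightarrow>\<^sub>M ?M" using that by (intro measurable_component_singleton) auto
    from measurable_compose[OF measurable_compose[OF measurable_fst this]
        component_measurable_cube_measure[OF that(1)]]
    show ?thesis .
  qed
  have pr: "Measurable.pred (?P \<Otimes>\<^sub>M ?M) (\<lambda>z. \<forall>l\<in>{..<d}. 0 \<le> fst z i l \<and> fst z i l < snd z l)"
    if "i < N" for i
  proof (intro pred_intros_finite)
    fix l assume "l \<in> {..<d}"
    then have [measurable]: "(\<lambda>z. fst z i l) \<in> borel_measurable (?P \<Otimes>\<^sub>M ?M)"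
        "(\<lambda>z. snd z l) \<in> borel_measurable (?P \<Otimes>\<^sub>M ?M)"
      using t w that by auto
    show "Measurable.pred (?P \<Otimes>\<^sub>M ?M) (\<lambda>z. 0 \<le> fst z i l \<and> fst z i l < snd z l)"
      by measurable
  qed auto
  have explicit: "(\<lambda>z. (\<Sum>i<N. if \<forall>l\<in>{..<d}. 0 \<le> fst z i l \<and> fst z i l < snd z l then 1 else 0 :: real)
      - real N * (\<Prod>l<d. snd z l)) \<in> borel_measurable (?P \<Otimes>\<^sub>M ?M)"
    by (intro borel_measurable_diff borel_measurable_sum borel_measurable_times
        borel_measurable_prod measurable_If pr t) auto
  have eq: "(\<Sum>i<N. if \<forall>l\<in>{..<d}. 0 \<le> fst z i l \<and> fst z i l < snd z l then 1 else 0 :: real)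
        - real N * (\<Prod>l<d. snd z l)
        = (case z of (\<omega>, t) \<Rightarrow> deviation ?M N (half_open_box d t) \<omega>)"
    if z: "z \<in> space (?P \<Otimes>\<^sub>M ?M)" for z
  proof -
    have "(if \<forall>l\<in>{..<d}. 0 \<le> fst z i l \<and> fst z i l < snd z l then 1 else 0 :: real)
        = indicator (half_open_box d (snd z)) (fst z i)" if "i < N" for i
    proof -
      have "fst z i \<in> unit_cube d"
        using z that by (auto simp: space_pair_measure mem_Times_iff space_PiM PiE_iff)
      then show ?thesis
        by (auto simp: half_open_box_def unit_cube_def PiE_iff indicator_def)
    qed
    moreover have "snd z \<in> unit_cube d" using z by (simp add: space_pair_measure mem_Times_iff)
    ultimately show ?thesis
      by (simp add: deviation_def measure_half_open_box case_prod_beta)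
  qed
  show ?thesis by (rule measurable_cong[THEN iffD1, OF _ explicit]) (rule eq)
qed

lemma nn_integral_exp_sq_deviation_boxes_le:
  assumes "N \<ge> 1"
  shows "(\<integral>\<^sup>+\<omega>. (\<integral>\<^sup>+t. ennreal (exp ((deviation (cube_measure d) N (half_open_box d t) \<omega>)\<^sup>2
            / (80 * real N)) - 1) \<partial>cube_measure d) \<partial>Pi\<^sub>M {..<N} (\<lambda>_. cube_measure d))
           \<le> ennreal (1 / 4)"
proof -
  let ?M = "cube_measure d"
  let ?P = "Pi\<^sub>M {..<N} (\<lambda>_. ?M)"
  interpret M: prob_space ?M by (rule prob_space_cube_measure)
  interpret P: prob_space ?P by (intro prob_space_PiM prob_space_cube_measure)
  interpret pair_sigma_finite ?M ?P ..
  have "(\<lambda>z. (case (snd z, fst z) of (\<omega>, t) \<Rightarrow> deviation ?M N (half_open_box d t) \<omega>))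
      \<in> borel_measurable (?M \<Otimes>\<^sub>M ?P)"
    by (rule measurable_compose[OF _ deviation_half_open_box_measurable]) measurable
  then have [measurable]: "(\<lambda>z. deviation ?M N (half_open_box d (fst z)) (snd z))
      \<in> borel_measurable (?M \<Otimes>\<^sub>M ?P)"
    by simp
  have "(\<integral>\<^sup>+\<omega>. (\<integral>\<^sup>+t. ennreal (exp ((deviation ?M N (half_open_box d t) \<omega>)\<^sup>2
            / (80 * real N)) - 1) \<partial>?M) \<partial>?P)
      = (\<integral>\<^sup>+t. (\<integral>\<^sup>+\<omega>. ennreal (exp ((deviation ?M N (half_open_box d t) \<omega>)\<^sup>2
            / (80 * real N)) - 1) \<partial>?P) \<partial>?M)"
    by (intro Fubini') (simp add: case_prod_beta')
  also have "\<dots> \<le> (\<integral>\<^sup>+t. ennreal (1 / 4) \<partial>?M)"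
    using assms by (intro nn_integral_mono nn_integral_exp_sq_deviation_le
        prob_space_cube_measure half_open_box_sets) auto
  also have "\<dots> = ennreal (1 / 4)" by (simp add: M.emeasure_space_1 del: space_cube_measure)
  finally show ?thesis .
qed

section \<open>Logarithmic grids of anchored boxes\<close>

text \<open>Lattice points in a simplex, counted by their generating function: each \<open>n \<in> S\<close> satisfies
  \<open>exp d * c\<^sup>\<Sigma>\<^sup>n \<ge> 1\<close> for \<open>c = exp (- 1 / B)\<close>, and the sum of these weights over a full
  product of intervals factorises into \<open>d\<close> geometric series.\<close>

lemma card_sum_bounded_le:
  fixes B :: real and d :: nat
  assumes "0 < B"
  defines "S \<equiv> {n \<in> Pi\<^sub>E {..<d} (\<lambda>_. UNIV :: nat set). real (\<Sum>i<d. n i) \<le> B * real d}"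
  shows "finite S" and "real (card S) \<le> (exp 1 * (1 + B)) ^ d"
proof -
  define m where "m = nat \<lfloor>B * real d\<rfloor>"
  define c where "c = exp (- (1 / B))"
  have c: "0 < c" "c < 1" using assms(1) by (auto simp: c_def)
  have sub: "S \<subseteq> Pi\<^sub>E {..<d} (\<lambda>_. {..m})"
  proof
    fix n assume n: "n \<in> S"
    have "n i \<le> m" if "i < d" for i
    proof -
      have "n i \<le> (\<Sum>i<d. n i)" using that by (intro member_le_sum) auto
      then have "real (n i) \<le> real (\<Sum>i<d. n i)" by (simp only: of_nat_le_iff)
      also have "\<dots> \<le> B * real d" using n by (simp only: S_def mem_Collect_eq)
      finally have "real (n i) \<le> B * real d" .
      then show ?thesis unfolding m_def by linarith
    qed
    then show "n \<in> Pi\<^sub>E {..<d} (\<lambda>_. {..m})" using n by (auto simp: S_def PiE_iff)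
  qed
  have fin: "finite (Pi\<^sub>E {..<d} (\<lambda>_. {..m}))" by (intro finite_PiE) auto
  then show "finite S" using sub by (rule finite_subset[rotated])
  have one: "1 \<le> exp (real d) * (\<Prod>i<d. c ^ n i)" if "n \<in> S" for n
  proof -
    have "(\<Prod>i<d. c ^ n i) = exp (- (real (\<Sum>i<d. n i) / B))"
      by (simp add: c_def exp_of_nat_mult[symmetric] exp_sum[symmetric] sum_negf sum_divide_distrib)
    moreover have "real (\<Sum>i<d. n i) / B \<le> real d"
      using that assms(1) by (simp add: S_def field_simps del: of_nat_sum)
    ultimately show ?thesis by (simp flip: exp_add)
  qed
  have "real (card S) = (\<Sum>n\<in>S. 1)" by simp
  also have "\<dots> \<le> (\<Sum>n\<in>S. exp (real d) * (\<Prod>i<d. c ^ n i))"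
    using one by (intro sum_mono)
  also have "\<dots> \<le> (\<Sum>n\<in>Pi\<^sub>E {..<d} (\<lambda>_. {..m}). exp (real d) * (\<Prod>i<d. c ^ n i))"
    using c fin sub by (intro sum_mono2) (auto intro!: mult_nonneg_nonneg prod_nonneg)
  also have "\<dots> = exp (real d) * (\<Prod>i<d. \<Sum>j\<le>m. c ^ j)"
    by (subst prod_sum_PiE) (auto simp: sum_distrib_left)
  also have "\<dots> = exp (real d) * (\<Sum>j\<le>m. c ^ j) ^ d" by simp
  also have "\<dots> \<le> exp (real d) * (1 + B) ^ d"
  proof (intro mult_left_mono power_mono)
    have "(\<Sum>j\<le>m. c ^ j) = (1 - c ^ Suc m) / (1 - c)" using c by (simp add: sum_gp0)
    also have "\<dots> \<le> 1 / (1 - c)" using c by (intro divide_right_mono) auto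
    also have "\<dots> \<le> 1 + B"
    proof -
      have "1 + 1 / B \<le> exp (1 / B)" by (rule exp_ge_add_one_self)
      then have "c \<le> 1 / (1 + 1 / B)"
        using assms(1) unfolding c_def exp_minus inverse_eq_divide
        by (intro divide_left_mono mult_pos_pos) (auto intro: add_pos_pos)
      also have "\<dots> = B / (1 + B)" using assms(1) by (simp add: field_simps)
      finally have "c * (1 + B) \<le> B" using assms(1) by (simp add: field_simps)
      then show ?thesis using c by (simp add: field_simps)
    qed
    finally show "(\<Sum>j\<le>m. c ^ j) \<le> 1 + B" .
  qed (use c in \<open>auto intro!: sum_nonneg\<close>)
  also have "\<dots> = (exp 1 * (1 + B)) ^ d"
    by (simp add: power_mult_distrib exp_of_nat_mult[symmetric])
  finally show "real (card S) \<le> (exp 1 * (1 + B)) ^ d" .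
qed

text \<open>A grid vector \<open>n\<close> at level \<open>k\<close> stands for the box with upper corner \<open>corner d k n\<close>. The bound on
  the coordinate sum says that this box has volume at least \<open>2\<^sup>-\<^sup>k\<close>.\<close>

definition grid :: "nat \<Rightarrow> nat \<Rightarrow> (nat \<Rightarrow> nat) set" where
  "grid d k = {n \<in> Pi\<^sub>E {..<d} (\<lambda>_. UNIV). real (\<Sum>i<d. n i) \<le> 2 ^ k * real k * ln 2 * real d}"

definition corner :: "nat \<Rightarrow> nat \<Rightarrow> (nat \<Rightarrow> nat) \<Rightarrow> nat \<Rightarrow> real" where
  "corner d k n i = exp (- (real (n i) / (2 ^ k * real d)))"

lemma corner_bounds: "0 < corner d k n i" "corner d k n i \<le> 1"
  by (auto simp: corner_def)

lemma prod_corner: "(\<Prod>i<d. corner d k n i) = exp (- (real (\<Sum>i<d. n i) / (2 ^ k * real d)))"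
  by (simp add: corner_def exp_sum[symmetric] sum_negf sum_divide_distrib)

text \<open>This absorbs the polynomial factor of the count into the next base: \<open>2\<close> is replaced by \<open>e\<close>. The
  induction step needs \<open>2 (k + 1) \<le> 2.7 k\<close>, which holds from \<open>k = 3\<close> on, so three cases are
  checked by hand.\<close>

lemma grid_growth: "1 + 2 ^ k * real k * ln 2 \<le> exp (real k)" if "k \<ge> 1"
  using that
proof (induction k rule: nat_less_induct)
  case (1 k)
  have e: "27 / 10 \<le> exp (1 :: real)" using e_approx_32 by (simp add: abs_if split: if_splits)
  have l: "0 < ln (2 :: real)" "ln (2 :: real) \<le> 25 / 36" by (simp, rule ln2_le_25_over_36)
  have e_pow: "(27 / 10) ^ k \<le> exp (real k)"
    using power_mono[OF e, of k] by (simp add: exp_of_nat_mult[symmetric])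
  consider "k = 1" | "k = 2" | "k = 3" | "k \<ge> 4" using 1 by linarith
  then show ?case
  proof cases
    case 4
    then obtain j where j: "k = Suc j" "j \<ge> 3" by (cases k) auto
    have "1 + 2 ^ k * real k * ln 2 = 1 + (2 ^ j * ln 2) * (2 * (real j + 1))"
      by (simp add: j algebra_simps)
    also have "\<dots> \<le> 27 / 10 + (2 ^ j * ln 2) * (27 / 10 * real j)"
      using j l by (intro add_mono mult_left_mono) auto
    also have "\<dots> = 27 / 10 * (1 + 2 ^ j * real j * ln 2)" by (simp add: algebra_simps)
    also have "\<dots> \<le> exp 1 * exp (real j)" using 1 j e l by (intro mult_mono) auto
    also have "\<dots> = exp (real k)" by (simp add: j exp_add[symmetric])
    finally show ?thesis .
  qed (use e_pow l in \<open>simp_all add: power2_eq_square power3_eq_cube\<close>)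
qed

lemma grid_finite: "finite (grid d k)"
proof (cases "k = 0")
  case True
  then have "grid d k \<subseteq> Pi\<^sub>E {..<d} (\<lambda>_. {0})"
    by (auto simp: grid_def PiE_iff extensional_def simp flip: of_nat_sum)
  then show ?thesis by (rule finite_subset) (auto intro!: finite_PiE)
next
  case False
  then show ?thesis
    unfolding grid_def by (intro card_sum_bounded_le) auto
qed

lemma card_grid_le:
  assumes "k \<ge> 1"
  shows "real (card (grid d k)) \<le> exp (real d * real (Suc k))"
proof -
  have "real (card (grid d k)) \<le> (exp 1 * (1 + 2 ^ k * real k * ln 2)) ^ d"
    unfolding grid_def using assms by (intro card_sum_bounded_le) auto
  also have "\<dots> \<le> (exp 1 * exp (real k)) ^ d"
    using grid_growth[OF assms] by (intro power_mono mult_left_mono) auto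
  also have "\<dots> = exp (real d * real (Suc k))"
    by (simp add: exp_of_nat_mult[symmetric] exp_add[symmetric] algebra_simps)
  finally show ?thesis .
qed

text \<open>Rounding up to the grid: \<open>u\<close> holds the negative logarithms of a corner. If the box is too small for the level
  (\<open>\<Sum>u > k log 2\<close>), its logarithms are first shrunk by the common factor \<open>\<theta>\<close> that brings its
  volume to \<open>2\<^sup>-\<^sup>k\<close> exactly; then the coordinates are rounded down to multiples of the mesh. Rounding changes
  the logarithm of the volume by at most \<open>2\<^sup>-\<^sup>k\<close>.\<close>

lemma grid_rounding:
  assumes d: "d \<ge> 1" and u: "\<And>i. i < d \<Longrightarrow> 0 \<le> u i"
  obtains n where "n \<in> grid d k" "\<And>i. i < d \<Longrightarrow> exp (- u i) \<le> corner d k n i"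
    "(\<Prod>i<d. corner d k n i) \<le> exp (- (\<Sum>i<d. u i)) + 2 / 2 ^ k"
proof -
  define U where "U = (\<Sum>i<d. u i)"
  define L where "L = real k * ln 2"
  \<comment> \<open>the reciprocal of the mesh width\<close>
  define h :: real where "h = 2 ^ k * real d"
  define \<theta> where "\<theta> = (if U \<le> L then 1 else L / U)"
  have h: "h > 0" using d by (simp add: h_def)
  have L: "0 \<le> L" by (simp add: L_def)
  have \<theta>: "0 \<le> \<theta>" "\<theta> \<le> 1" "\<theta> * U = min U L" using L by (auto simp: \<theta>_def min_def)
  define n where "n = (\<lambda>i\<in>{..<d}. nat \<lfloor>\<theta> * u i * h\<rfloor>)"
  have n: "real (n i) \<le> \<theta> * u i * h" "\<theta> * u i * h - 1 \<le> real (n i)" if "i < d" for i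
  proof -
    have "0 \<le> \<theta> * u i * h" using u[OF that] \<theta> h by simp
    then show "real (n i) \<le> \<theta> * u i * h" "\<theta> * u i * h - 1 \<le> real (n i)"
      using that by (auto simp: n_def of_nat_nat)
  qed
  have "(\<Sum>i<d. real (n i)) \<le> (\<Sum>i<d. \<theta> * u i * h)" using n by (intro sum_mono) auto
  also have theta_sum: "\<dots> = min U L * h"
    unfolding \<theta>(3)[symmetric] by (simp add: U_def sum_distrib_left sum_distrib_right)
  finally have up: "real (\<Sum>i<d. n i) \<le> min U L * h" by simp
  have "min U L * h - real d = (\<Sum>i<d. \<theta> * u i * h - 1)"
    using theta_sum by (simp add: sum_subtractf)
  also have "\<dots> \<le> (\<Sum>i<d. real (n i))" using n by (intro sum_mono) auto
  finally have lo: "min U L * h - real d \<le> real (\<Sum>i<d. n i)" by simp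
  show ?thesis
  proof
    have "min U L * h \<le> L * h" using h by (intro mult_right_mono) auto
    then show "n \<in> grid d k" using up by (auto simp: grid_def n_def L_def h_def algebra_simps)
    show "exp (- u i) \<le> corner d k n i" if "i < d" for i
    proof -
      have "real (n i) \<le> \<theta> * u i * h" using n that by simp
      also have "\<dots> \<le> 1 * u i * h" using \<theta> h u[OF that] by (intro mult_right_mono) auto
      finally have "real (n i) / h \<le> u i" using h by (simp add: field_simps)
      then show ?thesis by (simp add: corner_def h_def)
    qed
    have "real d / h = 1 / 2 ^ k" using d by (simp add: h_def)
    then have "min U L - 1 / 2 ^ k \<le> real (\<Sum>i<d. n i) / h"
      using divide_right_mono[OF lo, of h] h by (simp add: diff_divide_distrib)
    then have V: "(\<Prod>i<d. corner d k n i) \<le> exp (- min U L + 1 / 2 ^ k)"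
      by (simp add: prod_corner flip: h_def)
    have V1: "(\<Prod>i<d. corner d k n i) \<le> 1"
      using corner_bounds by (intro prod_le_1) (auto intro: less_imp_le)
    show "(\<Prod>i<d. corner d k n i) \<le> exp (- (\<Sum>i<d. u i)) + 2 / 2 ^ k"
    proof (cases "U \<le> L")
      case True
      define V where "V = (\<Prod>i<d. corner d k n i)"
      define \<delta> :: real where "\<delta> = 1 / 2 ^ k"
      have "V \<le> exp \<delta> * exp (- U)" using V True by (simp add: V_def \<delta>_def flip: exp_add)
      then have "exp (- \<delta>) * V \<le> exp (- U)" by (simp add: exp_minus field_simps)
      moreover have "1 - \<delta> \<le> exp (- \<delta>)" using exp_ge_add_one_self[of "- \<delta>"] by simp
      moreover have "0 \<le> V" unfolding V_def using corner_bounds by (intro prod_nonneg) (auto intro: less_imp_le)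
      ultimately have "(1 - \<delta>) * V \<le> exp (- U)" by (meson mult_right_mono order_trans)
      moreover have "\<delta> * V \<le> \<delta> * 1" using V1 by (intro mult_left_mono) (auto simp: V_def \<delta>_def)
      moreover have "0 \<le> \<delta>" by (simp add: \<delta>_def)
      ultimately have "V \<le> exp (- U) + 2 * \<delta>" by (simp add: algebra_simps)
      then show ?thesis by (simp add: V_def U_def \<delta>_def)
    next
      case False
      show ?thesis
      proof (cases "k = 0")
        case True
        then show ?thesis using V1 by (simp add: add_increasing)
      next
        case k: False
        have "(2::real) ^ 1 \<le> 2 ^ k" using k by (intro power_increasing) auto
        then have "norm (1 / 2 ^ k :: real) \<le> 1 / 2" by (simp add: field_simps)
        then have "exp (1 / 2 ^ k :: real) \<le> 2" using exp_bound_half[of "1 / 2 ^ k :: real"] by simp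
        moreover have "exp (- L) = 1 / 2 ^ k"
          by (simp add: L_def exp_minus exp_of_nat_mult inverse_eq_divide)
        ultimately have "exp (- L) * exp (1 / 2 ^ k) \<le> 1 / 2 ^ k * 2"
          by (intro mult_mono) auto
        then have "exp (- min U L + 1 / 2 ^ k) \<le> 2 / 2 ^ k"
          using False by (simp add: exp_add[symmetric] min_def)
        then show ?thesis using V by (simp add: add_increasing)
      qed
    qed
  qed
qed

section \<open>Dyadic chaining for the star discrepancy\<close>

abbreviation corner_box :: "nat \<Rightarrow> nat \<Rightarrow> (nat \<Rightarrow> nat) \<Rightarrow> (nat \<Rightarrow> real) set" where
  "corner_box d k n \<equiv> closed_box d (corner d k n)"

lemma corner_box_sets: "corner_box d k n \<in> sets (cube_measure d)"
  by (intro closed_box_sets corner_bounds)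

lemma measure_corner_box:
  "measure (cube_measure d) (corner_box d k n) = exp (- (real (\<Sum>i<d. n i) / (2 ^ k * real d)))"
  using corner_bounds
  by (subst measure_cube_measure)
    (auto intro!: closed_box_subset_unit_cube simp: measure_closed_box less_imp_le prod_corner
      simp del: of_nat_sum)

text \<open>The chain is built backwards, from fine to coarse: the parent of a box is obtained by rounding the box itself, so
  the set between the two is determined by \<open>n\<close> alone and the union bound ranges over a single grid.\<close>

lemma grid_parent_exists:
  assumes d: "d \<ge> 1"
  shows "\<exists>m\<in>grid d k. corner_box d (Suc k) n \<subseteq> corner_box d k m
    \<and> measure (cube_measure d) (corner_box d k m - corner_box d (Suc k) n) \<le> 2 / 2 ^ k"
proof -
  interpret prob_space "cube_measure d" by (rule prob_space_cube_measure)
  obtain m where m: "m \<in> grid d k"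
    "\<And>i. i < d \<Longrightarrow> exp (- (real (n i) / (2 ^ Suc k * real d))) \<le> corner d k m i"
    "(\<Prod>i<d. corner d k m i)
      \<le> exp (- (\<Sum>i<d. real (n i) / (2 ^ Suc k * real d))) + 2 / 2 ^ k"
    using grid_rounding[OF d, of "\<lambda>i. real (n i) / (2 ^ Suc k * real d)" k] by auto
  have sub: "corner_box d (Suc k) n \<subseteq> corner_box d k m"
    unfolding closed_box_def
  proof (intro PiE_mono)
    fix i assume "i \<in> {..<d}"
    then have "corner d (Suc k) n i \<le> corner d k m i" using m(2) by (simp add: corner_def)
    then show "{0..corner d (Suc k) n i} \<subseteq> {0..corner d k m i}" by auto
  qed
  moreover have "measure (cube_measure d) (corner_box d k m - corner_box d (Suc k) n)
      = measure (cube_measure d) (corner_box d k m) - measure (cube_measure d) (corner_box d (Suc k) n)"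
    using sub corner_box_sets by (intro finite_measure_Diff) auto
  moreover have "\<dots> \<le> 2 / 2 ^ k"
    using m(3) by (simp add: measure_corner_box prod_corner sum_divide_distrib)
  ultimately show ?thesis using m(1) by auto
qed

definition parent :: "nat \<Rightarrow> nat \<Rightarrow> (nat \<Rightarrow> nat) \<Rightarrow> nat \<Rightarrow> nat" where
  "parent d k n = (SOME m. m \<in> grid d k \<and> corner_box d (Suc k) n \<subseteq> corner_box d k m
    \<and> measure (cube_measure d) (corner_box d k m - corner_box d (Suc k) n) \<le> 2 / 2 ^ k)"

definition link :: "nat \<Rightarrow> nat \<Rightarrow> (nat \<Rightarrow> nat) \<Rightarrow> (nat \<Rightarrow> real) set" where
  "link d k n = corner_box d k (parent d k n) - corner_box d (Suc k) n"

lemma parent: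
  assumes "d \<ge> 1"
  shows "parent d k n \<in> grid d k" "corner_box d (Suc k) n \<subseteq> corner_box d k (parent d k n)"
    "measure (cube_measure d) (link d k n) \<le> 2 / 2 ^ k"
proof -
  have "\<exists>m. m \<in> grid d k \<and> corner_box d (Suc k) n \<subseteq> corner_box d k m
    \<and> measure (cube_measure d) (corner_box d k m - corner_box d (Suc k) n) \<le> 2 / 2 ^ k"
    using grid_parent_exists[OF assms] by blast
  from someI_ex[OF this]
  show "parent d k n \<in> grid d k" "corner_box d (Suc k) n \<subseteq> corner_box d k (parent d k n)"
    "measure (cube_measure d) (link d k n) \<le> 2 / 2 ^ k"
    by (simp_all add: parent_def link_def)
qed

lemma link_sets: "link d k n \<in> sets (cube_measure d)"
  unfolding link_def using corner_box_sets by auto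

text \<open>The exponent \<open>49/8 d (32/25)\<^sup>k\<close> achieved by the thresholds below has to pay for the entropy
  \<open>d (k + 2)\<close> of the grid at level \<open>k + 1\<close> and leave at least \<open>d (k + 3)\<close> for summing over the levels.\<close>

lemma geometric_beats_linear: "5 + 2 * real k \<le> 49 / 8 * (32 / 25) ^ k"
proof (induction k rule: nat_less_induct)
  case (1 k)
  consider "k = 0" | "k = 1" | "k = 2" | "k \<ge> 3" by linarith
  then show ?case
  proof cases
    case 4
    then obtain j where j: "k = Suc j" "j \<ge> 2" by (cases k) auto
    have "5 + 2 * real k \<le> 32 / 25 * (5 + 2 * real j)" using j by simp
    also have "\<dots> \<le> 32 / 25 * (49 / 8 * (32 / 25) ^ j)" using 1 j by (intro mult_left_mono) auto
    finally show ?thesis by (simp add: j)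
  qed (simp_all add: power2_eq_square)
qed

text \<open>The deviation allowed at level \<open>k\<close>. The ratio \<open>4/5\<close> exceeds \<open>1 / sqrt 2\<close>, the rate at which
  the standard deviation of a link decays, so that the failure exponent still grows geometrically
  (by \<open>2 (4/5)\<^sup>2 = 32/25\<close>); it is below 1, so that the thresholds are summable. The factor 7 is large
  enough for the first levels and makes the sum at most \<open>35 sqrt (d N)\<close>.\<close>

definition threshold :: "nat \<Rightarrow> nat \<Rightarrow> nat \<Rightarrow> real" where
  "threshold d N k = 7 * real N * sqrt (real d / real N) * (4 / 5) ^ k"

definition chain_failure :: "nat \<Rightarrow> nat \<Rightarrow> nat \<Rightarrow> (nat \<Rightarrow> nat \<Rightarrow> real) set" where
  "chain_failure d N K = (\<Union>k<K. \<Union>n\<in>grid d (Suc k).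
     {\<omega> \<in> space (Pi\<^sub>M {..<N} (\<lambda>_. cube_measure d)).
        threshold d N k \<le> \<bar>deviation (cube_measure d) N (link d k n) \<omega>\<bar>})"

lemma link_failure_sets:
  "{\<omega> \<in> space (Pi\<^sub>M {..<N} (\<lambda>_. cube_measure d)).
        s \<le> \<bar>deviation (cube_measure d) N (link d k n) \<omega>\<bar>} \<in> sets (Pi\<^sub>M {..<N} (\<lambda>_. cube_measure d))"
proof -
  have [measurable]: "link d k n \<in> sets (cube_measure d)" by (rule link_sets)
  show ?thesis by measurable
qed

lemma chain_failure_sets: "chain_failure d N K \<in> sets (Pi\<^sub>M {..<N} (\<lambda>_. cube_measure d))"
  unfolding chain_failure_def by (intro sets.finite_UN grid_finite link_failure_sets) auto

text \<open>A link has measure at most \<open>p = 2 / 2\<^sup>k\<close>, and the optimal parameter for threshold \<open>s\<close> is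
  \<open>c = s / (2 N p)\<close>. The hypothesis on \<open>k\<close>, which ends the chain at resolution \<open>sqrt (d / N)\<close>, is
  what keeps \<open>c \<le> 1\<close>.\<close>

lemma emeasure_link_failure:
  assumes d: "d \<ge> 1" and N: "N \<ge> 1" and k: "2 ^ Suc k * sqrt (real d / real N) \<le> 1"
  shows "emeasure (Pi\<^sub>M {..<N} (\<lambda>_. cube_measure d)) {\<omega> \<in> space (Pi\<^sub>M {..<N} (\<lambda>_. cube_measure d)).
        threshold d N k \<le> \<bar>deviation (cube_measure d) N (link d k n) \<omega>\<bar>}
      \<le> ennreal (2 * exp (- (real d * (5 + 2 * real k))))"
proof -
  define \<eta> where "\<eta> = sqrt (real d / real N)"
  \<comment> \<open>this is \<open>s / (2 N p)\<close> for the threshold \<open>s\<close> and \<open>p = 2 / 2\<^sup>k\<close>\<close>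
  define c where "c = 7 / 4 * \<eta> * (8 / 5) ^ k"
  have \<eta>: "0 \<le> \<eta>" "real N * \<eta>\<^sup>2 = real d" using N by (auto simp: \<eta>_def)
  have c0: "0 \<le> c" using \<eta> by (simp add: c_def)
  have "c \<le> 7 / 4 * \<eta> * 2 ^ k"
    unfolding c_def using \<eta> by (intro mult_left_mono power_mono) auto
  also have "\<dots> \<le> 1"
  proof -
    have "2 * (\<eta> * 2 ^ k) \<le> 1" using k by (simp add: \<eta>_def mult_ac)
    then have "7 / 4 * (\<eta> * 2 ^ k) \<le> 1" by linarith
    then show ?thesis by (simp only: mult.assoc)
  qed
  finally have c1: "c \<le> 1" .
  have base: "32 / 25 * 2 = 8 / 5 * (8 / 5 :: real)" "8 / 5 * (4 / 5) = (32 / 25 :: real)" by simp_all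
  have "((8 / 5) ^ k)\<^sup>2 = (32 / 25 :: real) ^ k * 2 ^ k"
    by (simp only: power2_eq_square base(1) flip: power_mult_distrib)
  then have pw: "2 / 2 ^ k * ((8 / 5) ^ k)\<^sup>2 = 2 * (32 / 25 :: real) ^ k"
    "(8 / 5) ^ k * (4 / 5) ^ k = (32 / 25 :: real) ^ k"
    by (simp, simp only: base(2) flip: power_mult_distrib)
  have "real N * (2 / 2 ^ k) * c\<^sup>2 = 49 / 16 * (real N * \<eta>\<^sup>2) * (2 / 2 ^ k * ((8 / 5) ^ k)\<^sup>2)"
    by (simp add: c_def power_mult_distrib power2_eq_square)
  also have "\<dots> = 49 / 8 * real d * (32 / 25) ^ k" unfolding pw \<eta> by simp
  finally have q: "real N * (2 / 2 ^ k) * c\<^sup>2 = 49 / 8 * real d * (32 / 25) ^ k" .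
  have "c * threshold d N k = 49 / 4 * (real N * \<eta>\<^sup>2) * ((8 / 5) ^ k * (4 / 5) ^ k)"
    by (simp add: c_def threshold_def \<eta>_def[symmetric] power2_eq_square)
  also have "\<dots> = 49 / 4 * real d * (32 / 25) ^ k" unfolding pw \<eta> by simp
  finally have l: "c * threshold d N k = 49 / 4 * real d * (32 / 25) ^ k" .
  have "emeasure (Pi\<^sub>M {..<N} (\<lambda>_. cube_measure d)) {\<omega> \<in> space (Pi\<^sub>M {..<N} (\<lambda>_. cube_measure d)).
        threshold d N k \<le> \<bar>deviation (cube_measure d) N (link d k n) \<omega>\<bar>}
      \<le> ennreal (2 * exp (real N * (2 / 2 ^ k) * c\<^sup>2 - c * threshold d N k))"
    by (intro emeasure_deviation_ge prob_space_cube_measure link_sets c0 c1 parent d)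
  also have "\<dots> \<le> ennreal (2 * exp (- (real d * (5 + 2 * real k))))"
  proof -
    have "real d * (5 + 2 * real k) \<le> real d * (49 / 8 * (32 / 25) ^ k)"
      by (intro mult_left_mono geometric_beats_linear) auto
    then show ?thesis unfolding q l by (intro ennreal_leI) simp
  qed
  finally show ?thesis .
qed

lemma emeasure_chain_failure:
  assumes d: "d \<ge> 1" and N: "N \<ge> 1" and K: "K = 0 \<or> 2 ^ K * sqrt (real d / real N) \<le> 1"
  shows "emeasure (Pi\<^sub>M {..<N} (\<lambda>_. cube_measure d)) (chain_failure d N K) < ennreal (1 / 2)"
proof -
  let ?P = "Pi\<^sub>M {..<N} (\<lambda>_. cube_measure d)"
  let ?F = "\<lambda>k n. {\<omega> \<in> space ?P. threshold d N k \<le> \<bar>deviation (cube_measure d) N (link d k n) \<omega>\<bar>}"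
  have "emeasure ?P (chain_failure d N K) \<le> (\<Sum>k<K. emeasure ?P (\<Union>n\<in>grid d (Suc k). ?F k n))"
    unfolding chain_failure_def
    by (intro emeasure_subadditive_finite) (auto intro!: sets.finite_UN grid_finite link_failure_sets)
  also have "\<dots> \<le> (\<Sum>k<K. ennreal ((1 / 2) ^ (k + 2)))"
  proof (intro sum_mono)
    fix k assume k: "k \<in> {..<K}"
    have "2 ^ Suc k * sqrt (real d / real N) \<le> 2 ^ K * sqrt (real d / real N)"
      using k by (intro mult_right_mono power_increasing) auto
    then have *: "2 ^ Suc k * sqrt (real d / real N) \<le> 1" using K k by auto
    have "emeasure ?P (\<Union>n\<in>grid d (Suc k). ?F k n) \<le> (\<Sum>n\<in>grid d (Suc k). emeasure ?P (?F k n))"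
      by (intro emeasure_subadditive_finite grid_finite) (auto intro!: link_failure_sets)
    also have "\<dots> \<le> (\<Sum>n\<in>grid d (Suc k). ennreal (2 * exp (- (real d * (5 + 2 * real k)))))"
      by (intro sum_mono emeasure_link_failure d N *)
    also have "\<dots> = ennreal (real (card (grid d (Suc k))) * (2 * exp (- (real d * (5 + 2 * real k)))))"
      by (simp add: ennreal_mult ennreal_of_nat_eq_real_of_nat)
    also have "\<dots> \<le> ennreal ((1 / 2) ^ (k + 2))"
    proof (intro ennreal_leI)
      have "real (card (grid d (Suc k))) * (2 * exp (- (real d * (5 + 2 * real k))))
          \<le> exp (real d * real (Suc (Suc k))) * (2 * exp (- (real d * (5 + 2 * real k))))"
        by (intro mult_right_mono card_grid_le) auto
      also have "\<dots> = 2 * exp (- (real d * real (k + 3)))"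
        by (simp add: exp_add[symmetric] algebra_simps)
      also have "\<dots> \<le> 2 * exp (- (1 * real (k + 3)))"
      proof -
        have "1 * real (k + 3) \<le> real d * real (k + 3)" using d by (intro mult_right_mono) auto
        then have "exp (- (real d * real (k + 3))) \<le> exp (- (1 * real (k + 3)))"
          by (simp only: exp_le_cancel_iff neg_le_iff_le)
        then show ?thesis by (intro mult_left_mono) auto
      qed
      also have "\<dots> = 2 * exp (- 1) ^ (k + 3)" by (simp add: exp_of_nat_mult[symmetric])
      \<comment> \<open>the crude bound \<open>e \<ge> 2\<close> makes the level failures sum to strictly less than 1/2\<close>
      also have "\<dots> \<le> 2 * (1 / 2) ^ (k + 3)"
        using exp_ge_add_one_self[of 1]
        by (intro mult_left_mono power_mono) (auto simp: exp_minus field_simps)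
      also have "\<dots> = (1 / 2) ^ (k + 2)" by (simp add: power_add power3_eq_cube power2_eq_square)
      finally show "real (card (grid d (Suc k))) * (2 * exp (- (real d * (5 + 2 * real k))))
          \<le> (1 / 2) ^ (k + 2)" .
    qed
    finally show "emeasure ?P (\<Union>n\<in>grid d (Suc k). ?F k n) \<le> ennreal ((1 / 2) ^ (k + 2))" .
  qed
  also have "\<dots> = ennreal (\<Sum>k<K. (1 / 2) ^ (k + 2))" by (intro sum_ennreal) auto
  also have "(\<Sum>k<K. (1 / 2) ^ (k + 2)) = (1 / 2 - (1 / 2) ^ Suc K :: real)"
    by (induction K) (auto simp: field_simps)
  also have "ennreal (1 / 2 - (1 / 2) ^ Suc K) < ennreal (1 / 2)"
    by (intro ennreal_lessI) auto
  finally show ?thesis .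
qed

text \<open>Outside the failure event the deviations of the links add up along the chain. The chain starts
  at the whole cube, the only box of level 0, whose deviation vanishes.\<close>

lemma deviation_corner_box_le:
  assumes d: "d \<ge> 1" and \<omega>: "\<omega> \<in> space (Pi\<^sub>M {..<N} (\<lambda>_. cube_measure d))"
    "\<omega> \<notin> chain_failure d N K" and "k \<le> K" "n \<in> grid d k"
  shows "\<bar>deviation (cube_measure d) N (corner_box d k n) \<omega>\<bar> \<le> (\<Sum>j<k. threshold d N j)"
  using assms(4,5)
proof (induction k arbitrary: n)
  case 0
  have "corner_box d 0 n = unit_cube d"
    using 0 by (auto simp: grid_def corner_def closed_box_def unit_cube_def PiE_iff simp flip: of_nat_sum)
  moreover have "(\<Sum>i<N. indicator (unit_cube d) (\<omega> i)) = real N"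
    using \<omega> by (auto simp: space_PiM PiE_iff)
  moreover have "measure (cube_measure d) (unit_cube d) = 1"
    using prob_space.prob_space[OF prob_space_cube_measure] by simp
  ultimately show ?case by (simp add: deviation_def del: sum_indicator_eq_card)
next
  case (Suc k)
  let ?D = "\<lambda>A. deviation (cube_measure d) N A \<omega>"
  have "?D (link d k n) = ?D (corner_box d k (parent d k n)) - ?D (corner_box d (Suc k) n)"
    unfolding link_def
    by (intro deviation_Diff prob_space_cube_measure corner_box_sets parent d)
  moreover have "\<bar>?D (link d k n)\<bar> < threshold d N k"
    using Suc.prems \<omega> by (force simp: chain_failure_def not_le)
  moreover have "\<bar>?D (corner_box d k (parent d k n))\<bar> \<le> (\<Sum>j<k. threshold d N j)"
    using Suc.prems parent(1)[OF d] by (intro Suc.IH) auto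
  ultimately show ?case by simp
qed

lemma sum_threshold_le:
  "(\<Sum>j<k. threshold d N j) \<le> 35 * real N * sqrt (real d / real N)"
proof -
  have "(\<Sum>j<k. (4 / 5) ^ j :: real) = 5 * (1 - (4 / 5) ^ k)"
    by (induction k) (simp_all add: algebra_simps)
  also have "\<dots> \<le> 5" by simp
  finally have "7 * real N * sqrt (real d / real N) * (\<Sum>j<k. (4 / 5) ^ j)
      \<le> 7 * real N * sqrt (real d / real N) * 5"
    by (intro mult_left_mono) auto
  then show ?thesis by (simp add: threshold_def sum_distrib_left)
qed

text \<open>An anchored box is squeezed between two grid boxes. The outer one comes from \<open>grid_rounding\<close>. An inner
  one is found by rounding the other way, which stays in the grid only if the volume is at least
  \<open>3 / 2\<^sup>K\<close>; for smaller boxes the trivial lower bound \<open>- N vol\<close> suffices.\<close>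

lemma deviation_half_open_box_sandwich:
  assumes d: "d \<ge> 1" and t: "t \<in> unit_cube d"
    and S: "\<And>n. n \<in> grid d K \<Longrightarrow> \<bar>deviation (cube_measure d) N (corner_box d K n) \<omega>\<bar> \<le> S"
    and "0 \<le> S"
  shows "\<bar>deviation (cube_measure d) N (half_open_box d t) \<omega>\<bar> \<le> S + 3 * real N / 2 ^ K"
proof (cases "\<exists>i<d. t i = 0")
  case True
  then obtain i where "i < d" "{0..<t i} = {}" by auto
  then have "half_open_box d t = {}" unfolding half_open_box_def PiE_eq_empty_iff by blast
  then show ?thesis using \<open>0 \<le> S\<close> by (simp add: deviation_def)
next
  case False
  let ?D = "\<lambda>A. deviation (cube_measure d) N A \<omega>"
  let ?vol = "\<Prod>i<d. t i"
  have t01: "0 < t i" "t i \<le> 1" if "i < d" for i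
    using t False that by (auto simp: unit_cube_def PiE_iff less_le)
  define u where "u i = - ln (t i)" for i
  have u: "0 \<le> u i" "exp (- u i) = t i" if "i < d" for i
    using t01[OF that] by (auto simp: u_def)
  have vol: "exp (- (\<Sum>i<d. u i)) = ?vol"
    unfolding sum_negf[symmetric] by (simp add: exp_sum u)
  have vol0: "0 < ?vol" using t01 by (intro prod_pos) auto
  define h :: real where "h = 2 ^ K * real d"
  have h: "0 < h" using d by (simp add: h_def)
  have meas: "measure (cube_measure d) (half_open_box d t) = ?vol" by (rule measure_half_open_box[OF t])
  have upper: "?D (half_open_box d t) \<le> S + 2 * real N / 2 ^ K"
  proof -
    obtain n where n: "n \<in> grid d K" "\<And>i. i < d \<Longrightarrow> exp (- u i) \<le> corner d K n i"
      "(\<Prod>i<d. corner d K n i) \<le> exp (- (\<Sum>i<d. u i)) + 2 / 2 ^ K"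
      using grid_rounding[OF d, of u K] u by auto
    have "half_open_box d t \<subseteq> corner_box d K n"
      unfolding half_open_box_def closed_box_def using n(2) u
      by (intro PiE_mono) fastforce
    from deviation_mono[OF this, where M = "cube_measure d" and N = N and \<omega> = \<omega>]
    have "?D (half_open_box d t) \<le> ?D (corner_box d K n)
        + real N * (measure (cube_measure d) (corner_box d K n) - ?vol)"
      by (simp add: meas)
    also have "\<dots> \<le> S + real N * (2 / 2 ^ K)"
      using n(3) S[OF n(1)]
      by (intro add_mono mult_left_mono) (auto simp: measure_corner_box prod_corner vol)
    finally show ?thesis by (simp add: mult.commute)
  qed
  have lower: "- (S + 3 * real N / 2 ^ K) \<le> ?D (half_open_box d t)"
  proof (cases "?vol < 3 / 2 ^ K")
    case True
    have "0 \<le> (\<Sum>i<N. indicator (half_open_box d t) (\<omega> i) :: real)" by (intro sum_nonneg) auto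
    then have "- (real N * ?vol) \<le> ?D (half_open_box d t)"
      by (simp add: deviation_def meas del: sum_indicator_eq_card)
    moreover have "real N * ?vol \<le> real N * (3 / 2 ^ K)" using True by (intro mult_left_mono) auto
    ultimately show ?thesis using \<open>0 \<le> S\<close> by simp
  next
    case False
    \<comment> \<open>floor plus one instead of the ceiling: a closed box must fit into a half-open one, so the inequality has to be strict\<close>
    define n where "n = (\<lambda>i\<in>{..<d}. nat \<lfloor>u i * h\<rfloor> + 1)"
    have n: "u i * h < real (n i)" "real (n i) \<le> u i * h + 1" if "i < d" for i
    proof -
      have "0 \<le> u i * h" using u that h by simp
      then have "real (n i) = of_int \<lfloor>u i * h\<rfloor> + 1"
        using that by (simp add: n_def of_nat_nat)
      then show "u i * h < real (n i)" "real (n i) \<le> u i * h + 1"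
        by linarith+
    qed
    have "(\<Sum>i<d. real (n i)) \<le> (\<Sum>i<d. u i * h + 1)" using n by (intro sum_mono) auto
    also have "\<dots> = (\<Sum>i<d. u i) * h + real d" by (simp add: sum.distrib sum_distrib_right)
    also have "real d = 1 / 2 ^ K * h" by (simp add: h_def)
    finally have nsum: "real (\<Sum>i<d. n i) \<le> ((\<Sum>i<d. u i) + 1 / 2 ^ K) * h"
      by (simp add: algebra_simps)
    have grid: "n \<in> grid d K"
    proof -
      \<comment> \<open>rounding up costs at most 1 in the sum of the logarithms, and \<open>ln 3 > 1\<close> pays for it\<close>
      have "ln (3 / 2 ^ K) \<le> ln (exp (- (\<Sum>i<d. u i)))"
        using False vol0 unfolding vol by (subst ln_le_cancel_iff) auto
      then have "(\<Sum>i<d. u i) \<le> real K * ln 2 - ln 3" by (simp add: ln_div ln_realpow)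
      moreover have "1 / 2 ^ K \<le> (1::real)" by simp
      ultimately have "(\<Sum>i<d. u i) + 1 / 2 ^ K \<le> real K * ln 2" using ln3_gt_1 by linarith
      then have "((\<Sum>i<d. u i) + 1 / 2 ^ K) * h \<le> real K * ln 2 * h" using h by (intro mult_right_mono) auto
      then have "real (\<Sum>i<d. n i) \<le> 2 ^ K * real K * ln 2 * real d"
        using nsum by (simp add: h_def algebra_simps)
      then show ?thesis unfolding grid_def by (simp add: n_def)
    qed
    have sub: "corner_box d K n \<subseteq> half_open_box d t"
      unfolding half_open_box_def closed_box_def
    proof (intro PiE_mono)
      fix i assume "i \<in> {..<d}"
      then have i: "i < d" by simp
      have "u i < real (n i) / h" using n(1)[OF i] h by (simp add: field_simps)
      then have "corner d K n i < exp (- u i)" by (simp add: corner_def h_def)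
      then show "{0..corner d K n i} \<subseteq> {0..<t i}" using u(2)[OF i] by auto
    qed
    have "?vol - 1 / 2 ^ K \<le> measure (cube_measure d) (corner_box d K n)"
    proof -
      have "?vol * (1 - 1 / 2 ^ K) \<le> ?vol * exp (- (1 / 2 ^ K))"
        using vol0 exp_ge_add_one_self[of "- (1 / 2 ^ K)"] by (intro mult_left_mono) auto
      also have "\<dots> = exp (- ((\<Sum>i<d. u i) + 1 / 2 ^ K))"
        unfolding vol[symmetric] by (simp flip: exp_add)
      also have "\<dots> \<le> exp (- (real (\<Sum>i<d. n i) / h))"
        using nsum h by (simp add: field_simps del: of_nat_sum)
      finally have "?vol * (1 - 1 / 2 ^ K) \<le> measure (cube_measure d) (corner_box d K n)"
        by (simp add: measure_corner_box h_def)
      moreover have "?vol * (1 / 2 ^ K) \<le> 1 * (1 / 2 ^ K)"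
        using t01 by (intro mult_right_mono prod_le_1) (auto intro: less_imp_le)
      ultimately show ?thesis by (simp add: algebra_simps)
    qed
    then have "real N * (?vol - measure (cube_measure d) (corner_box d K n)) \<le> real N * (1 / 2 ^ K)"
      by (intro mult_left_mono) auto
    moreover have "?D (corner_box d K n) \<le> ?D (half_open_box d t)
        + real N * (?vol - measure (cube_measure d) (corner_box d K n))"
      using deviation_mono[OF sub, where M = "cube_measure d" and N = N and \<omega> = \<omega>] by (simp add: meas)
    moreover have "real N / 2 ^ K \<le> 3 * real N / 2 ^ K" by (intro divide_right_mono) auto
    ultimately show ?thesis using S[OF grid] by (simp add: abs_le_iff)
  qed
  have "2 * real N / 2 ^ K \<le> 3 * real N / 2 ^ K" by (intro divide_right_mono) auto
  then show ?thesis using upper lower by (simp add: abs_le_iff)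
qed

section \<open>A point set with small star discrepancy and Gaussian tails\<close>

text \<open>The depth of the chain: \<open>2\<^sup>-\<^sup>K\<close> is comparable to \<open>x = sqrt (d / N)\<close>. If \<open>x > 1\<close> the depth
  is 0 and only the trivial chain remains.\<close>

lemma dyadic_scale_exists:
  fixes x :: real
  assumes "0 < x"
  obtains K :: nat where "K = 0 \<or> 2 ^ K * x \<le> 1" "1 \<le> 2 ^ Suc K * x"
proof -
  obtain m :: nat where "1 / x < 2 ^ m" using real_arch_pow[of 2 "1 / x"] by auto
  then have ex: "1 < 2 ^ m * x" using assms by (simp add: field_simps)
  define L where "L = (LEAST m. 1 < 2 ^ m * x)"
  have L: "1 < 2 ^ L * x" unfolding L_def using ex by (rule LeastI)
  show ?thesis
  proof (cases L)
    case 0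
    then show ?thesis using L assms by (intro that[of 0]) auto
  next
    case (Suc K)
    have "\<not> 1 < 2 ^ K * x" using not_less_Least[of K "\<lambda>m. 1 < 2 ^ m * x"] Suc by (auto simp: L_def)
    then show ?thesis using L Suc by (intro that[of K]) auto
  qed
qed

lemma local_discrepancy_sample:
  assumes "inj_on \<omega> {..<N}" "N \<ge> 1" "t \<in> unit_cube d"
  shows "local_discrepancy d (\<omega> ` {..<N}) t
    = deviation (cube_measure d) N (half_open_box d t) \<omega> / real N"
proof -
  have "card {x \<in> \<omega> ` {..<N}. x \<in> half_open_box d t} = card (\<omega> ` {i \<in> {..<N}. \<omega> i \<in> half_open_box d t})"
    by (intro arg_cong[where f = card]) auto
  also have "\<dots> = card {i \<in> {..<N}. \<omega> i \<in> half_open_box d t}"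
    using assms(1) by (intro card_image) (auto intro: inj_on_subset)
  also have "real \<dots> = (\<Sum>i<N. indicator (half_open_box d t) (\<omega> i))"
    by (simp add: indicator_def if_distrib sum.If_cases Int_def)
  finally have "real (card {x \<in> \<omega> ` {..<N}. x \<in> half_open_box d t})
      = (\<Sum>i<N. indicator (half_open_box d t) (\<omega> i))" .
  moreover have "measure (lebesgue_dim d) (closed_box d t) = (\<Prod>i<d. t i)"
    using assms(3) by (intro measure_closed_box) (auto simp: unit_cube_def PiE_iff)
  ultimately show ?thesis
    using assms by (simp add: local_discrepancy_def deviation_def card_image measure_half_open_box
        diff_divide_distrib del: sum_indicator_eq_card)
qed

text \<open>The failure events have total probability less than 1: at most \<open>1/2\<close> from Markov's inequality,
  less than \<open>1/2\<close> from the chaining, and 0 from coincidences. The chain contributes 35 to the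
  constant of the star discrepancy and the sandwich at most 6, which leaves a reserve below 51.\<close>

theorem good_point_set_exists:
  assumes d: "d \<ge> 1" and N: "N \<ge> 1"
  obtains P where "finite P" "P \<subseteq> unit_cube d" "card P = N"
    "\<And>t. t \<in> unit_cube d \<Longrightarrow> \<bar>local_discrepancy d P t\<bar> \<le> 51 * sqrt (real d / real N)"
    "local_discrepancy d P \<in> borel_measurable (cube_measure d)"
    "(\<integral>\<^sup>+t. ennreal (exp (real N * (local_discrepancy d P t)\<^sup>2 / 80) - 1) \<partial>cube_measure d)
       \<le> ennreal (1 / 2)"
proof -
  let ?M = "cube_measure d"
  let ?P = "Pi\<^sub>M {..<N} (\<lambda>_. ?M)"
  interpret M: prob_space ?M by (rule prob_space_cube_measure)
  interpret P: prob_space ?P by (intro prob_space_PiM prob_space_cube_measure)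
  define \<eta> where "\<eta> = sqrt (real d / real N)"
  have \<eta>: "0 < \<eta>" using d N by (simp add: \<eta>_def)
  obtain K where K: "K = 0 \<or> 2 ^ K * \<eta> \<le> 1" "1 \<le> 2 ^ Suc K * \<eta>"
    using dyadic_scale_exists[OF \<eta>] .
  define J where "J \<omega> = (\<integral>\<^sup>+t. ennreal (exp ((deviation ?M N (half_open_box d t) \<omega>)\<^sup>2
      / (80 * real N)) - 1) \<partial>?M)" for \<omega>
  have J_meas [measurable]: "J \<in> borel_measurable ?P"
    unfolding J_def[abs_def]
  proof (rule M.borel_measurable_nn_integral)
    show "(\<lambda>(\<omega>, t). ennreal (exp ((deviation ?M N (half_open_box d t) \<omega>)\<^sup>2 / (80 * real N)) - 1))
        \<in> borel_measurable (?P \<Otimes>\<^sub>M ?M)"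
      using deviation_half_open_box_measurable[of d N] unfolding case_prod_beta' by measurable
  qed
  define F where "F = {\<omega> \<in> space ?P. 1 \<le> 2 * J \<omega>}"
  have F_sets: "F \<in> sets ?P" unfolding F_def by measurable
  have "emeasure ?P F \<le> 2 * (\<integral>\<^sup>+\<omega>. J \<omega> * indicator (space ?P) \<omega> \<partial>?P)"
    unfolding F_def by (intro nn_integral_Markov_inequality) auto
  also have "(\<integral>\<^sup>+\<omega>. J \<omega> * indicator (space ?P) \<omega> \<partial>?P) = (\<integral>\<^sup>+\<omega>. J \<omega> \<partial>?P)"
    by (intro nn_integral_cong) auto
  also have "2 * \<dots> \<le> 2 * ennreal (1 / 4)"
    unfolding J_def by (intro mult_left_mono nn_integral_exp_sq_deviation_boxes_le N) auto
  also have "\<dots> = ennreal (1 / 2)"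
    by (simp flip: ennreal_numeral ennreal_mult)
  finally have F_le: "emeasure ?P F \<le> ennreal (1 / 2)" .
  have C_less: "emeasure ?P (chain_failure d N K) < ennreal (1 / 2)"
    using K(1) by (intro emeasure_chain_failure d N) (simp add: \<eta>_def)
  obtain Z where Z: "{\<omega> \<in> space ?P. \<not> inj_on \<omega> {..<N}} \<subseteq> Z" "emeasure ?P Z = 0" "Z \<in> sets ?P"
    using AE_inj_on_cube_sample[OF d, of N] by (rule AE_E)
  have "emeasure ?P (F \<union> chain_failure d N K \<union> Z)
      \<le> emeasure ?P F + emeasure ?P (chain_failure d N K) + emeasure ?P Z"
    using F_sets Z(3) chain_failure_sets
    by (meson add_right_mono emeasure_subadditive order_trans sets.Un)
  also have "\<dots> < 1"
  proof -
    have "measure ?P F + measure ?P (chain_failure d N K) < 1"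
    proof -
      have "measure ?P F \<le> 1 / 2"
        using F_le unfolding P.emeasure_eq_measure by (subst (asm) ennreal_le_iff) auto
      moreover have "measure ?P (chain_failure d N K) < 1 / 2"
        using C_less unfolding P.emeasure_eq_measure by (subst (asm) ennreal_less_iff) auto
      ultimately show ?thesis by simp
    qed
    then have "ennreal (measure ?P F + measure ?P (chain_failure d N K)) < ennreal 1"
      by (intro ennreal_lessI) auto
    then show ?thesis using Z(2) by (simp add: P.emeasure_eq_measure ennreal_plus)
  qed
  finally have "F \<union> chain_failure d N K \<union> Z \<noteq> space ?P"
    using P.emeasure_space_1 by force
  moreover have "F \<union> chain_failure d N K \<union> Z \<subseteq> space ?P"
    using F_sets Z(3) chain_failure_sets sets.sets_into_space by (metis Un_least)
  ultimately obtain \<omega> where \<omega>: "\<omega> \<in> space ?P" "\<omega> \<notin> F" "\<omega> \<notin> chain_failure d N K" "\<omega> \<notin> Z"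
    by blast
  have inj: "inj_on \<omega> {..<N}" using \<omega> Z(1) by blast
  show ?thesis
  proof
    show "finite (\<omega> ` {..<N})" by simp
    show "\<omega> ` {..<N} \<subseteq> unit_cube d" using \<omega>(1) by (auto simp: space_PiM)
    show "card (\<omega> ` {..<N}) = N" using inj by (simp add: card_image)
    show "\<bar>local_discrepancy d (\<omega> ` {..<N}) t\<bar> \<le> 51 * sqrt (real d / real N)"
      if t: "t \<in> unit_cube d" for t
    proof -
      have "\<bar>deviation ?M N (half_open_box d t) \<omega>\<bar> \<le> 35 * real N * \<eta> + 3 * real N / 2 ^ K"
        using deviation_corner_box_le[OF d \<omega>(1,3) order_refl] sum_threshold_le[where d = d and N = N and k = K]
          t \<eta> by (intro deviation_half_open_box_sandwich d) (auto simp: \<eta>_def[symmetric] intro: order_trans)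
      also have "3 * real N / 2 ^ K \<le> 3 * real N * (2 * \<eta>)"
      proof -
        have "1 / 2 ^ K \<le> 2 * \<eta>" using K(2) by (simp add: field_simps)
        then have "3 * real N * (1 / 2 ^ K) \<le> 3 * real N * (2 * \<eta>)" by (intro mult_left_mono) auto
        then show ?thesis by simp
      qed
      also have "35 * real N * \<eta> + 3 * real N * (2 * \<eta>) \<le> real N * (51 * \<eta>)" using \<eta> by simp
      finally show ?thesis
        using N by (simp add: local_discrepancy_sample[OF inj N t] \<eta>_def field_simps)
    qed
    have "(\<lambda>t. deviation ?M N (half_open_box d t) \<omega>) \<in> borel_measurable ?M"
      using measurable_compose[OF measurable_Pair1'[OF \<omega>(1)] deviation_half_open_box_measurable[of d N]]
      by simp
    then have dev: "(\<lambda>t. deviation ?M N (half_open_box d t) \<omega> / real N) \<in> borel_measurable ?M"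
      by measurable
    show "local_discrepancy d (\<omega> ` {..<N}) \<in> borel_measurable ?M"
      by (rule measurable_cong[THEN iffD1, OF _ dev]) (simp add: local_discrepancy_sample[OF inj N])
    have "(\<integral>\<^sup>+t. ennreal (exp (real N * (local_discrepancy d (\<omega> ` {..<N}) t)\<^sup>2 / 80) - 1) \<partial>?M) = J \<omega>"
      unfolding J_def
    proof (intro nn_integral_cong)
      fix t assume "t \<in> space ?M"
      then have "t \<in> unit_cube d" by simp
      from local_discrepancy_sample[OF inj N this] N
      have "real N * (local_discrepancy d (\<omega> ` {..<N}) t)\<^sup>2 / 80
          = (deviation ?M N (half_open_box d t) \<omega>)\<^sup>2 / (80 * real N)"
        by (simp add: power2_eq_square)
      then show "ennreal (exp (real N * (local_discrepancy d (\<omega> ` {..<N}) t)\<^sup>2 / 80) - 1)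
          = ennreal (exp ((deviation ?M N (half_open_box d t) \<omega>)\<^sup>2 / (80 * real N)) - 1)"
        by simp
    qed
    also have "J \<omega> \<le> ennreal (1 / 2)"
    proof (rule ccontr)
      assume "\<not> J \<omega> \<le> ennreal (1 / 2)"
      then have "2 * ennreal (1 / 2) \<le> 2 * J \<omega>" by (intro mult_left_mono) auto
      moreover have "2 * ennreal (1 / 2) = 1"
        unfolding ennreal_numeral[symmetric] by (subst ennreal_mult[symmetric]) auto
      ultimately show False using \<omega>(1,2) by (simp add: F_def)
    qed
    finally show "(\<integral>\<^sup>+t. ennreal (exp (real N * (local_discrepancy d (\<omega> ` {..<N}) t)\<^sup>2 / 80) - 1)
          \<partial>?M) \<le> ennreal (1 / 2)" .
  qed
qed

section \<open>The norm of the initial discrepancy\<close>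

text \<open>Bernoulli's inequality for a real exponent, obtained from the weighted arithmetic-geometric mean
  of \<open>\<alpha> x + 1\<close> and 1.\<close>

lemma ln_linear_le:
  fixes \<alpha> x :: real
  assumes "\<alpha> \<ge> 1" "x \<ge> 0"
  shows "ln (\<alpha> * x + 1) \<le> \<alpha> * ln (x + 1)"
proof -
  have pos: "0 < \<alpha> * x + 1" using assms by (simp add: add_nonneg_pos)
  have "(\<alpha> * x + 1) powr (1 / \<alpha>) * 1 powr (1 - 1 / \<alpha>) \<le> 1 / \<alpha> * (\<alpha> * x + 1) + (1 - 1 / \<alpha>) * 1"
    using assms pos by (intro Youngs_inequality_0) auto
  also have "1 / \<alpha> * (\<alpha> * x + 1) + (1 - 1 / \<alpha>) * 1 = x + 1"
    using assms by (simp add: field_simps)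
  finally have "(\<alpha> * x + 1) powr (1 / \<alpha>) \<le> x + 1" by simp
  then have "ln ((\<alpha> * x + 1) powr (1 / \<alpha>)) \<le> ln (x + 1)"
    using pos assms by (subst ln_le_cancel_iff) auto
  then show ?thesis using pos assms by (simp add: ln_powr field_simps)
qed

lemma psi_mono:
  assumes "0 \<le> x" "x \<le> y" "0 \<le> \<alpha>"
  shows "psi \<alpha> x \<le> psi \<alpha> y"
  using assms by (simp add: psi_def powr_mono2)

text \<open>The norm of the initial discrepancy is at least this quantity to the power \<open>- 1 / \<alpha>\<close>.\<close>

definition initial_scale :: "real \<Rightarrow> nat \<Rightarrow> real" where
  "initial_scale \<alpha> d = 2 * exp 1 * \<alpha> * real d * ln (real d + 1)"

text \<open>Let \<open>V = (1 - w)\<^sup>d\<close> be the volume of the cube with all coordinates at least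
  \<open>w = exp (- 1 / (\<alpha> d))\<close>, where the product of the coordinates is at least \<open>exp (- 1 / \<alpha>)\<close>. An
  admissible \<open>K\<close> satisfies \<open>(exp (K\<^sup>-\<^sup>\<alpha> / e) - 1) V \<le> 1\<close>, hence \<open>K\<^sup>-\<^sup>\<alpha> \<le> e log (2 / V)\<close>, and
  \<open>1 / (1 - w) \<le> \<alpha> d + 1\<close>. The choice of \<open>w\<close> costs only the constant \<open>e\<close> and no
  power of \<open>\<alpha> d\<close>.\<close>

lemma orlicz_norm_empty_ge:
  assumes \<alpha>: "\<alpha> \<ge> 1" and d: "d \<ge> 1"
  shows "ennreal (initial_scale \<alpha> d powr (- 1 / \<alpha>)) \<le> orlicz_norm \<alpha> d (local_discrepancy d {})"
  unfolding orlicz_norm_def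
proof (rule Inf_greatest)
  fix z
  assume "z \<in> ennreal ` {K. K > 0 \<and>
    (\<integral>\<^sup>+x\<in>unit_cube d. ennreal (psi \<alpha> (\<bar>local_discrepancy d {} x\<bar> / K)) \<partial>lebesgue_dim d) \<le> 1}"
  then obtain K where z: "z = ennreal K" and K: "0 < K" and adm: "(\<integral>\<^sup>+x\<in>unit_cube d. ennreal (psi \<alpha> (\<bar>local_discrepancy d {} x\<bar> / K))
      \<partial>lebesgue_dim d) \<le> 1"
    by blast
  define Y where "Y = initial_scale \<alpha> d"
  define w where "w = exp (- 1 / (\<alpha> * real d))"
  define y where "y = K powr (- \<alpha>)"
  define E where "E = Pi\<^sub>E {..<d} (\<lambda>_. {w..1})"
  have ad: "0 < \<alpha> * real d" using \<alpha> d by simp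
  have w: "0 < w" "w < 1" using ad by (auto simp: w_def)
  have wd: "w ^ d = exp (- 1 / \<alpha>)"
    using d \<alpha> by (simp add: w_def exp_of_nat_mult[symmetric])
  have y: "0 < y" using K by (simp add: y_def)
  have E_sets: "E \<in> sets (lebesgue_dim d)" unfolding E_def by (intro box_in_sets_lebesgue_dim) auto
  have E_vol: "emeasure (lebesgue_dim d) E = ennreal ((1 - w) ^ d)"
    unfolding E_def using w by (subst emeasure_lebesgue_dim_box) (auto simp: ennreal_power)
  have E_sub: "E \<subseteq> unit_cube d"
    unfolding E_def unit_cube_def using w by (intro PiE_mono) auto
  define c where "c = exp (exp (- 1) * y) - 1"
  have c: "0 \<le> c" using y by (simp add: c_def)
  have c_le: "c \<le> psi \<alpha> (\<bar>local_discrepancy d {} x\<bar> / K)" if x: "x \<in> E" for x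
  proof -
    have xi: "w \<le> x i" if "i < d" for i using x that by (auto simp: E_def PiE_iff)
    have "w ^ d \<le> (\<Prod>i<d. x i)"
      using w xi prod_mono[of "{..<d}" "\<lambda>_. w" x] by simp
    then have "exp (- 1 / \<alpha>) \<le> (\<Prod>i<d. x i)" by (simp add: wd)
    moreover have "\<bar>local_discrepancy d {} x\<bar> = \<bar>\<Prod>i<d. x i\<bar>"
      using x E_sub by (subst local_discrepancy_empty) auto
    ultimately have "exp (- 1 / \<alpha>) / K \<le> \<bar>local_discrepancy d {} x\<bar> / K"
      using K by (intro divide_right_mono) auto
    then have "psi \<alpha> (exp (- 1 / \<alpha>) / K) \<le> psi \<alpha> (\<bar>local_discrepancy d {} x\<bar> / K)"
      using K \<alpha> by (intro psi_mono) auto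
    moreover have "(exp (- 1 / \<alpha>) / K) powr \<alpha> = exp (- 1) * y"
      using K \<alpha> by (simp add: powr_divide powr_minus_divide y_def exp_powr_real)
    ultimately show ?thesis by (simp add: psi_def c_def)
  qed
  have "ennreal (c * (1 - w) ^ d) = (\<integral>\<^sup>+x. ennreal c * indicator E x \<partial>lebesgue_dim d)"
    using E_sets c w by (simp add: nn_integral_cmult_indicator E_vol ennreal_mult)
  also have "\<dots> \<le> (\<integral>\<^sup>+x\<in>unit_cube d. ennreal (psi \<alpha> (\<bar>local_discrepancy d {} x\<bar> / K)) \<partial>lebesgue_dim d)"
    using c_le E_sub by (intro nn_integral_mono) (auto simp: indicator_def intro: ennreal_leI)
  also note adm
  finally have cV: "c * (1 - w) ^ d \<le> 1"
    by (metis ennreal_1 ennreal_le_iff zero_le_one)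
  have inv: "1 / (1 - w) \<le> \<alpha> * real d + 1"
  proof -
    have "1 + 1 / (\<alpha> * real d) \<le> exp (1 / (\<alpha> * real d))" by (rule exp_ge_add_one_self)
    then have "w * (1 + 1 / (\<alpha> * real d)) \<le> w * exp (1 / (\<alpha> * real d))"
      using w by (intro mult_left_mono) auto
    also have "\<dots> = 1" by (simp add: w_def flip: exp_add)
    finally have "w * (\<alpha> * real d + 1) \<le> \<alpha> * real d" using ad \<alpha> d by (simp add: field_simps)
    then show ?thesis using w by (simp add: field_simps)
  qed
  define q where "q = \<alpha> * real d + 1"
  have q: "1 \<le> q" using ad by (simp add: q_def)
  have "1 \<le> q * (1 - w)" using inv w by (simp add: q_def field_simps)
  then have qV: "1 \<le> q ^ d * (1 - w) ^ d" by (simp flip: power_mult_distrib)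
  have "c * 1 \<le> c * (q ^ d * (1 - w) ^ d)" using qV c by (intro mult_left_mono)
  also have "\<dots> = q ^ d * (c * (1 - w) ^ d)" by simp
  also have "\<dots> \<le> q ^ d * 1" using cV q by (intro mult_left_mono) auto
  finally have "exp (exp (- 1) * y) \<le> 2 * q ^ d"
    using one_le_power[OF q, of d] by (simp add: c_def)
  then have "ln (exp (exp (- 1) * y)) \<le> ln (2 * q ^ d)"
    using q by (subst ln_le_cancel_iff) auto
  then have ey: "exp (- 1) * y \<le> ln 2 + real d * ln q"
    using q by (simp add: ln_mult ln_realpow)
  have "ln 2 \<le> ln (real d + 1)" using d by (subst ln_le_cancel_iff) auto
  also have "\<dots> = 1 * ln (real d + 1)" by simp
  also have "\<dots> \<le> \<alpha> * real d * ln (real d + 1)"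
    using \<alpha> d mult_mono[of 1 \<alpha> 1 "real d"] by (intro mult_right_mono) auto
  finally have ln2: "ln 2 \<le> \<alpha> * real d * ln (real d + 1)" .
  have "real d * ln q \<le> real d * (\<alpha> * ln (real d + 1))"
    using ln_linear_le[OF \<alpha>, of "real d"] by (intro mult_left_mono) (auto simp: q_def)
  then have "real d * ln q \<le> \<alpha> * real d * ln (real d + 1)" by (simp only: mult_ac)
  with ln2 ey have "exp (- 1) * y \<le> 2 * \<alpha> * real d * ln (real d + 1)" by linarith
  then have "exp 1 * (exp (- 1) * y) \<le> exp 1 * (2 * \<alpha> * real d * ln (real d + 1))"
    by (intro mult_left_mono) auto
  moreover have "exp 1 * (exp (- 1) * y) = y" by (simp add: mult.assoc[symmetric] flip: exp_add)
  ultimately have "y \<le> exp 1 * (2 * \<alpha> * real d * ln (real d + 1))" by (simp only:)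
  then have yY: "y \<le> Y" by (simp add: Y_def initial_scale_def mult_ac)
  have "Y powr (- 1 / \<alpha>) \<le> y powr (- 1 / \<alpha>)"
    using yY y \<alpha> by (intro powr_mono2') auto
  also have "\<dots> = K" using K \<alpha> by (simp add: y_def powr_powr)
  finally show "ennreal (initial_scale \<alpha> d powr (- 1 / \<alpha>)) \<le> z"
    unfolding z Y_def by (rule ennreal_leI)
qed

section \<open>The norm of the discrepancy of a good point set\<close>

text \<open>\<open>N\<close> times the square of a bound for the norm of the discrepancy of a good \<open>N\<close>-point set. For
  \<open>\<alpha> > 2\<close> it is the geometric mean of the constant of the square integral and of that of the star
  discrepancy, \<open>51\<^sup>2 d\<close>, with weights \<open>2 / \<alpha>\<close> and \<open>1 - 2 / \<alpha>\<close>.\<close>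

definition sample_scale :: "real \<Rightarrow> nat \<Rightarrow> real" where
  "sample_scale \<alpha> d = (if \<alpha> \<le> 2 then 80 else 80 powr (2 / \<alpha>) * (2601 * real d) powr (1 - 2 / \<alpha>))"

text \<open>The additive constant \<open>1/4\<close> only contributes a factor \<open>exp (1/4) \<le> 4/3\<close> to the Orlicz integral,
  small enough for a bound \<open>1/2\<close> on the square integral to remain sufficient.\<close>

lemma powr_le_square_plus:
  fixes x \<alpha> :: real
  assumes "0 \<le> x" "1 \<le> \<alpha>" "\<alpha> \<le> 2"
  shows "x powr \<alpha> \<le> x\<^sup>2 + 1 / 4"
proof (cases "x \<le> 1")
  case True
  then have "x powr \<alpha> \<le> x powr 1"
    using assms by (intro powr_mono') auto
  also have "\<dots> \<le> x\<^sup>2 + 1 / 4"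
    using assms(1) sum_squares_ge_zero[of "x - 1 / 2" 0] by (simp add: power2_eq_square algebra_simps)
  finally show ?thesis .
next
  case False
  then have "x powr \<alpha> \<le> x powr 2" using assms by (intro powr_mono) auto
  also have "\<dots> = x\<^sup>2" using False by (simp add: powr_numeral)
  finally show ?thesis by simp
qed

text \<open>The scale \<open>K\<close> is chosen such that \<open>(\<bar>\<Delta>\<bar> / K)\<^sup>\<alpha>\<close> is dominated by \<open>N \<Delta>\<^sup>2 / 80\<close>: up to an
  additive constant if \<open>\<alpha> \<le> 2\<close>, and after replacing \<open>\<bar>\<Delta>\<bar>\<^sup>\<alpha>\<^sup>-\<^sup>2\<close> by the power of the
  uniform bound \<open>D\<close> otherwise.\<close>

lemma min_disc_le:
  assumes \<alpha>: "\<alpha> \<ge> 1" and d: "d \<ge> 1" and N: "N \<ge> 1"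
  shows "min_disc \<alpha> N d \<le> ennreal (sqrt (sample_scale \<alpha> d / real N))"
proof -
  obtain P where P: "finite P" "P \<subseteq> unit_cube d" "card P = N"
    and star: "\<And>t. t \<in> unit_cube d \<Longrightarrow> \<bar>local_discrepancy d P t\<bar> \<le> 51 * sqrt (real d / real N)"
    and meas [measurable]: "local_discrepancy d P \<in> borel_measurable (cube_measure d)"
    and sq: "(\<integral>\<^sup>+t. ennreal (exp (real N * (local_discrepancy d P t)\<^sup>2 / 80) - 1) \<partial>cube_measure d)
       \<le> ennreal (1 / 2)"
    using good_point_set_exists[OF d N] by blast
  define K where "K = sqrt (sample_scale \<alpha> d / real N)"
  have K: "0 < K" using N d by (simp add: K_def sample_scale_def)
  let ?\<Delta> = "local_discrepancy d P"
  let ?M = "cube_measure d"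
  interpret M: prob_space ?M by (rule prob_space_cube_measure)
  have "(\<integral>\<^sup>+t. ennreal (psi \<alpha> (\<bar>?\<Delta> t\<bar> / K)) \<partial>?M) \<le> 1"
  proof (cases "\<alpha> \<le> 2")
    case True
    define b :: real where "b = exp (1 / 4)"
    have b: "1 \<le> b" "b \<le> 4 / 3"
      using exp_bound[of "1 / 4"] by (auto simp: b_def power2_eq_square)
    have K2: "K\<^sup>2 = 80 / real N" using True N by (simp add: K_def sample_scale_def)
    have pt: "psi \<alpha> (\<bar>?\<Delta> t\<bar> / K) \<le> b * (exp (real N * (?\<Delta> t)\<^sup>2 / 80) - 1) + (b - 1)" for t
    proof -
      have "(\<bar>?\<Delta> t\<bar> / K) powr \<alpha> \<le> (\<bar>?\<Delta> t\<bar> / K)\<^sup>2 + 1 / 4"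
        using K \<alpha> True by (intro powr_le_square_plus) auto
      also have "(\<bar>?\<Delta> t\<bar> / K)\<^sup>2 = real N * (?\<Delta> t)\<^sup>2 / 80"
        by (simp add: power_divide K2)
      finally have "exp ((\<bar>?\<Delta> t\<bar> / K) powr \<alpha>) \<le> exp (real N * (?\<Delta> t)\<^sup>2 / 80 + 1 / 4)" by simp
      also have "\<dots> = b * exp (real N * (?\<Delta> t)\<^sup>2 / 80)" by (simp add: b_def exp_add)
      finally show ?thesis by (simp add: psi_def algebra_simps)
    qed
    let ?g = "\<lambda>t. ennreal (exp (real N * (?\<Delta> t)\<^sup>2 / 80) - 1)"
    have "(\<integral>\<^sup>+t. ennreal (psi \<alpha> (\<bar>?\<Delta> t\<bar> / K)) \<partial>?M) \<le> (\<integral>\<^sup>+t. ennreal b * ?g t + ennreal (b - 1) \<partial>?M)"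
    proof (intro nn_integral_mono)
      fix t
      have "ennreal (psi \<alpha> (\<bar>?\<Delta> t\<bar> / K)) \<le> ennreal (b * (exp (real N * (?\<Delta> t)\<^sup>2 / 80) - 1) + (b - 1))"
        using pt by (rule ennreal_leI)
      also have "\<dots> = ennreal b * ?g t + ennreal (b - 1)"
        using b by (subst ennreal_plus) (auto simp: ennreal_mult)
      finally show "ennreal (psi \<alpha> (\<bar>?\<Delta> t\<bar> / K)) \<le> ennreal b * ?g t + ennreal (b - 1)" .
    qed
    also have "\<dots> = ennreal b * (\<integral>\<^sup>+t. ?g t \<partial>?M) + ennreal (b - 1)"
      by (subst nn_integral_add, measurable, subst nn_integral_cmult, measurable)
        (simp add: M.emeasure_space_1 del: space_cube_measure)
    also have "\<dots> \<le> ennreal b * ennreal (1 / 2) + ennreal (b - 1)"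
      using sq by (intro add_right_mono mult_left_mono) auto
    also have "\<dots> = ennreal (b * (1 / 2) + (b - 1))"
    proof -
      have "ennreal b * ennreal (1 / 2) = ennreal (b * (1 / 2))"
        using b by (intro ennreal_mult[symmetric]) auto
      then show ?thesis using b by (simp only:) (intro ennreal_plus[symmetric], auto)
    qed
    also have "\<dots> \<le> ennreal 1" using b by (intro ennreal_leI) simp
    finally show ?thesis by simp
  next
    case False
    define D where "D = 51 * sqrt (real d / real N)"
    have D: "0 < D" using d N by (simp add: D_def)
    have D2: "D\<^sup>2 = 2601 * real d / real N" by (simp add: D_def power_mult_distrib)
    have Ka: "K powr \<alpha> = 80 / real N * D powr (\<alpha> - 2)"
    proof -
      have "K powr \<alpha> = (sample_scale \<alpha> d / real N) powr (\<alpha> / 2)"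
        using K by (simp add: K_def powr_half_sqrt[symmetric] powr_powr sample_scale_def)
      also have "sample_scale \<alpha> d / real N
          = (80 / real N) powr (2 / \<alpha>) * (2601 * real d / real N) powr (1 - 2 / \<alpha>)"
        using False N d by (simp add: sample_scale_def powr_divide powr_add[symmetric])
      also have "\<dots> powr (\<alpha> / 2) = 80 / real N * (2601 * real d / real N) powr ((\<alpha> - 2) / 2)"
      proof -
        have "2 / \<alpha> * (\<alpha> / 2) = 1" "(1 - 2 / \<alpha>) * (\<alpha> / 2) = (\<alpha> - 2) / 2"
          using \<alpha> by (simp_all add: field_simps)
        then show ?thesis using N d by (simp only: powr_mult powr_powr) simp
      qed
      also have "2601 * real d / real N = D powr 2" using D by (simp add: D2 powr_numeral)
      also have "(D powr 2) powr ((\<alpha> - 2) / 2) = D powr (\<alpha> - 2)"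
        by (subst powr_powr) (rule arg_cong[where f = "\<lambda>x. D powr x"], simp add: field_simps)
      finally show ?thesis .
    qed
    have "(\<integral>\<^sup>+t. ennreal (psi \<alpha> (\<bar>?\<Delta> t\<bar> / K)) \<partial>?M)
        \<le> (\<integral>\<^sup>+t. ennreal (exp (real N * (?\<Delta> t)\<^sup>2 / 80) - 1) \<partial>?M)"
    proof (intro nn_integral_mono ennreal_leI)
      fix t assume "t \<in> space ?M"
      then have t: "t \<in> unit_cube d" by simp
      show "psi \<alpha> (\<bar>?\<Delta> t\<bar> / K) \<le> exp (real N * (?\<Delta> t)\<^sup>2 / 80) - 1"
      proof (cases "?\<Delta> t = 0")
        case nz: False
        have "(\<bar>?\<Delta> t\<bar> / K) powr \<alpha> = \<bar>?\<Delta> t\<bar> powr 2 * \<bar>?\<Delta> t\<bar> powr (\<alpha> - 2) / K powr \<alpha>"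
        proof -
          have "\<bar>?\<Delta> t\<bar> powr \<alpha> = \<bar>?\<Delta> t\<bar> powr 2 * \<bar>?\<Delta> t\<bar> powr (\<alpha> - 2)"
            by (subst powr_add[symmetric]) simp
          then show ?thesis by (simp only: powr_divide)
        qed
        also have "\<dots> \<le> \<bar>?\<Delta> t\<bar> powr 2 * D powr (\<alpha> - 2) / K powr \<alpha>"
          using star[OF t] False by (intro divide_right_mono mult_left_mono powr_mono2) (auto simp: D_def)
        also have "\<dots> = real N * (?\<Delta> t)\<^sup>2 / 80" using D nz by (simp add: Ka powr_numeral)
        finally show ?thesis by (simp add: psi_def)
      qed (simp add: psi_def)
    qed
    also note sq
    also have "ennreal (1 / 2) \<le> ennreal 1" by (intro ennreal_leI) simp
    finally show ?thesis by simp
  qed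
  then have "orlicz_norm \<alpha> d ?\<Delta> \<le> ennreal K"
    unfolding orlicz_norm_def nn_integral_cube_measure using K by (intro Inf_lower) auto
  moreover have "min_disc \<alpha> N d \<le> orlicz_norm \<alpha> d ?\<Delta>"
    unfolding min_disc_def using P by (intro INF_lower) auto
  ultimately show ?thesis unfolding K_def by (rule order_trans[rotated])
qed

section \<open>Counting the points\<close>

lemma inv_disc_le:
  assumes \<alpha>: "\<alpha> \<ge> 1" and d: "d \<ge> 1" and N: "N \<ge> 1" and \<epsilon>: "0 < \<epsilon>"
    and large: "sample_scale \<alpha> d * initial_scale \<alpha> d powr (2 / \<alpha>) * \<epsilon> powr (- 2) \<le> real N"
  shows "inv_disc \<alpha> \<epsilon> d \<le> enat N"
proof -
  define Y where "Y = initial_scale \<alpha> d"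
  have Y: "0 < Y" using \<alpha> d by (simp add: Y_def initial_scale_def)
  have "sample_scale \<alpha> d * Y powr (2 / \<alpha>) / \<epsilon>\<^sup>2 \<le> real N"
    using large \<epsilon> by (simp add: Y_def powr_minus powr_numeral divide_inverse)
  then have "sample_scale \<alpha> d / real N \<le> \<epsilon>\<^sup>2 / Y powr (2 / \<alpha>)"
    using N \<epsilon> Y by (simp add: field_simps)
  also have "Y powr (2 / \<alpha>) = (Y powr (1 / \<alpha>))\<^sup>2"
    by (simp add: power2_eq_square flip: powr_add)
  also have "\<epsilon>\<^sup>2 / \<dots> = (\<epsilon> * Y powr (- 1 / \<alpha>))\<^sup>2"
    by (simp add: power_mult_distrib powr_minus power_inverse divide_inverse)
  finally have "sqrt (sample_scale \<alpha> d / real N) \<le> \<epsilon> * Y powr (- 1 / \<alpha>)"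
    using \<epsilon> by (intro real_le_lsqrt) auto
  then have "ennreal (sqrt (sample_scale \<alpha> d / real N)) \<le> ennreal (\<epsilon> * Y powr (- 1 / \<alpha>))"
    by (rule ennreal_leI)
  also have "\<dots> = ennreal \<epsilon> * ennreal (Y powr (- 1 / \<alpha>))" using \<epsilon> by (intro ennreal_mult) auto
  also have "\<dots> \<le> ennreal \<epsilon> * orlicz_norm \<alpha> d (local_discrepancy d {})"
    unfolding Y_def by (intro mult_left_mono orlicz_norm_empty_ge \<alpha> d) auto
  finally have "min_disc \<alpha> N d \<le> ennreal \<epsilon> * orlicz_norm \<alpha> d (local_discrepancy d {})"
    using min_disc_le[OF \<alpha> d N] by (rule order_trans[rotated])
  then show ?thesis unfolding inv_disc_def using N by (intro Inf_lower) auto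
qed

text \<open>The ratio \<open>r\<close> is Stirling's upper bound for \<open>n!\<close> at \<open>n = 1\<close>, about 1.002.
  The third inequality decides the case \<open>\<alpha> = 1\<close>, which is the tightest one for \<open>\<alpha> \<le> 2\<close>; it needs
  \<open>r \<ge> 0.96\<close>, hence the approximation of \<open>e\<close> to two decimals.\<close>

lemma stirling_ratio_bounds:
  defines "r \<equiv> sqrt (2 * pi) / exp (11 / 12)"
  shows "0 < r" "r \<le> 4" "80 * (2 * exp 1 / r)\<^sup>2 \<le> 2601" "160 * exp 1 / r \<le> 2601"
proof -
  show r0: "0 < r" by (simp add: r_def)
  have "sqrt (2 * pi) \<le> sqrt (4\<^sup>2)" using pi_less_4 by (intro real_sqrt_le_mono) simp
  then have "sqrt (2 * pi) / exp (11 / 12) \<le> 4 / 1" by (intro frac_le) auto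
  then show "r \<le> 4" by (simp add: r_def)
  have "sqrt (2.5\<^sup>2) \<le> sqrt (2 * pi)"
    using pi_approx by (intro real_sqrt_le_mono) (simp add: power2_eq_square)
  then have s: "5 / 2 \<le> sqrt (2 * pi)" by simp
  have "exp (11 / 12) * (13 / 12) \<le> exp (11 / 12) * exp (1 / 12 :: real)"
    using exp_ge_add_one_self[of "1 / 12"] by (intro mult_left_mono) auto
  also have "\<dots> = exp 1" by (simp flip: exp_add)
  also have "exp 1 < (272 / 100 :: real)" by (rule e_less_272)
  finally have e: "exp (11 / 12) \<le> (272 / 100 * (12 / 13) :: real)" by simp
  have "2 * exp 1 / r = 2 * exp 1 * exp (11 / 12) / sqrt (2 * pi)" by (simp add: r_def)
  also have "\<dots> \<le> 2 * (272 / 100) * (272 / 100 * (12 / 13)) / (5 / 2)"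
    using e s e_less_272 by (intro frac_le mult_mono) auto
  also have "\<dots> \<le> 5.47" by simp
  finally have q: "2 * exp 1 / r \<le> 5.47" .
  have "(2 * exp 1 / r)\<^sup>2 \<le> 5.47\<^sup>2" using q r0 by (intro power_mono) auto
  then show "80 * (2 * exp 1 / r)\<^sup>2 \<le> 2601" by (simp add: power2_eq_square)
  show "160 * exp 1 / r \<le> 2601" using q by simp
qed

text \<open>All powers of \<open>\<alpha>\<close>, \<open>d\<close> and the logarithm agree, so only numerical constants are compared:
  \<open>80 (2 e)\<^sup>s \<le> 2601 r\<^sup>s\<close> for \<open>1 \<le> s \<le> 2\<close>, and \<open>(160 e)\<^sup>s 2601\<^sup>1\<^sup>-\<^sup>s \<le> 2601 r\<^sup>s\<close> for
  \<open>s < 1\<close>, where \<open>s = 2 / \<alpha>\<close>.\<close>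

lemma scales_le_tractability_const:
  assumes \<alpha>: "\<alpha> \<ge> 1" and d: "d \<ge> 1"
  shows "sample_scale \<alpha> d * initial_scale \<alpha> d powr (2 / \<alpha>)
    \<le> tractability_const \<alpha> * real d powr max 1 (2 / \<alpha>) * ln (real d + 1) powr (2 / \<alpha>)"
proof -
  define s where "s = 2 / \<alpha>"
  define r where "r = sqrt (2 * pi) / exp (11 / 12)"
  define L where "L = ln (real d + 1)"
  define e where "e = 2 * exp (1 :: real)"
  note r = stirling_ratio_bounds[folded r_def]
  have s: "0 < s" "s \<le> 2" using \<alpha> by (auto simp: s_def field_simps)
  have L: "0 < L" using d by (simp add: L_def)
  have e: "2 < e" by (simp add: e_def)
  have Y: "initial_scale \<alpha> d powr s = e powr s * \<alpha> powr s * real d powr s * L powr s"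
    using \<alpha> L e by (simp add: initial_scale_def e_def L_def powr_mult)
  have C: "tractability_const \<alpha> = 2601 * \<alpha> powr s * r powr s"
    by (simp add: tractability_const_def s_def r_def)
  have "sample_scale \<alpha> d * (e powr s * real d powr s) \<le> 2601 * r powr s * real d powr max 1 s"
  proof (cases "\<alpha> \<le> 2")
    case True
    then have s1: "1 \<le> s" using \<alpha> by (simp add: s_def)
    have "1 \<le> e / r"
      using r(1,2) exp_ge_add_one_self[of 1] by (simp add: e_def)
    then have "(e / r) powr s \<le> (e / r) powr 2" using s by (intro powr_mono) auto
    also have "\<dots> = (e / r)\<^sup>2" using r e by (simp add: powr_numeral)
    finally have "80 * (e / r) powr s \<le> 2601" using r(3) by (simp add: e_def)
    then have "80 * e powr s \<le> 2601 * r powr s" using r(1) e by (simp add: powr_divide field_simps)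
    then have "80 * e powr s * real d powr s \<le> 2601 * r powr s * real d powr s"
      by (intro mult_right_mono) auto
    then show ?thesis using True s1 by (simp add: sample_scale_def max_def)
  next
    case False
    then have s1: "s < 1" using \<alpha> by (simp add: s_def)
    have "(80 * e) powr s \<le> (2601 * r) powr s"
      using r e s by (intro powr_mono2) (auto simp: e_def field_simps)
    then have "80 powr s * e powr s \<le> 2601 powr s * r powr s"
      using r e by (simp add: powr_mult)
    then have "80 powr s * e powr s * 2601 powr (1 - s) * real d
        \<le> 2601 powr s * r powr s * 2601 powr (1 - s) * real d"
      by (intro mult_right_mono) auto
    also have "\<dots> = (2601 powr s * 2601 powr (1 - s)) * r powr s * real d" by simp
    also have "2601 powr s * 2601 powr (1 - s) = (2601 :: real)" by (simp flip: powr_add)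
    finally have *: "80 powr s * e powr s * 2601 powr (1 - s) * real d \<le> 2601 * r powr s * real d" .
    have dd: "real d powr (1 - s) * real d powr s = real d" using d by (simp flip: powr_add)
    have "sample_scale \<alpha> d * (e powr s * real d powr s)
        = 80 powr s * e powr s * 2601 powr (1 - s) * (real d powr (1 - s) * real d powr s)"
      using False by (simp add: sample_scale_def s_def[symmetric] powr_mult)
    also have "\<dots> \<le> 2601 * r powr s * real d" unfolding dd by (rule *)
    finally show ?thesis using s1 d by (simp add: max_def)
  qed
  then have "sample_scale \<alpha> d * (e powr s * real d powr s) * (\<alpha> powr s * L powr s)
      \<le> 2601 * r powr s * real d powr max 1 s * (\<alpha> powr s * L powr s)"
    by (intro mult_right_mono) auto
  then show ?thesis
    unfolding s_def[symmetric] L_def[symmetric] Y C by (simp add: mult_ac)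
qed

lemma inv_disc_bound:
  assumes \<alpha>: "\<alpha> \<ge> 1" and d: "d \<ge> 1" and \<epsilon>: "0 < \<epsilon>"
  shows "inv_disc \<alpha> \<epsilon> d \<le> enat (nat \<lceil>tractability_const \<alpha> * real d powr max 1 (2 / \<alpha>)
                        * ln (real d + 1) powr (2 / \<alpha>) * \<epsilon> powr (- 2)\<rceil>)"
proof -
  define X where "X = tractability_const \<alpha> * real d powr max 1 (2 / \<alpha>)
                        * ln (real d + 1) powr (2 / \<alpha>) * \<epsilon> powr (- 2)"
  have X: "0 < X" using assms by (simp add: X_def tractability_const_def)
  have "sample_scale \<alpha> d * initial_scale \<alpha> d powr (2 / \<alpha>) * \<epsilon> powr (- 2) \<le> X"
    unfolding X_def by (intro mult_right_mono scales_le_tractability_const \<alpha> d) auto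
  also have "X \<le> real (nat \<lceil>X\<rceil>)" by (rule real_nat_ceiling_ge)
  finally have "sample_scale \<alpha> d * initial_scale \<alpha> d powr (2 / \<alpha>) * \<epsilon> powr (- 2) \<le> real (nat \<lceil>X\<rceil>)" .
  moreover have "nat \<lceil>X\<rceil> \<ge> 1" using X by linarith
  ultimately show ?thesis unfolding X_def[symmetric] by (intro inv_disc_le \<alpha> d \<epsilon>)
qed

text \<open>The logarithm is absorbed by the surplus \<open>d\<^sup>\<tau>\<^sup>-\<^sup>m\<close>, where \<open>m = max 1 (2 / \<alpha>)\<close>; the summand
  1 in the constant \<open>C\<close> accounts for rounding up to an integer.\<close>

lemma tractability_bound_above_exponent:
  assumes \<alpha>: "\<alpha> \<ge> 1" and \<tau>: "max 1 (2 / \<alpha>) < \<tau>"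
  shows "\<exists>C>0. tractability_bound \<alpha> C \<tau> 2"
proof -
  define m where "m = max 1 (2 / \<alpha>)"
  define s where "s = 2 / \<alpha>"
  define b where "b = (\<tau> - m) / s"
  define A where "A = 2 powr (\<tau> - m) / b powr s"
  have s: "0 < s" using \<alpha> by (simp add: s_def)
  have b: "0 < b" using \<tau> s by (simp add: b_def m_def)
  have C0: "0 < tractability_const \<alpha>" using \<alpha> by (simp add: tractability_const_def)
  have A: "0 < A" using b by (simp add: A_def)
  have ln_le: "ln (real d + 1) powr s \<le> A * real d powr (\<tau> - m)" if d: "d \<ge> 1" for d
  proof -
    have "ln (real d + 1) \<le> (real d + 1) powr b / b" using b by (intro ln_powr_bound) auto
    then have "ln (real d + 1) powr s \<le> ((real d + 1) powr b / b) powr s"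
      using s by (intro powr_mono2) auto
    also have "\<dots> = (real d + 1) powr (\<tau> - m) / b powr s"
      using b s by (simp add: powr_divide powr_powr) (simp add: b_def)
    also have "\<dots> \<le> (2 * real d) powr (\<tau> - m) / b powr s"
      using d \<tau> by (intro divide_right_mono powr_mono2) (auto simp: m_def)
    also have "\<dots> = A * real d powr (\<tau> - m)" by (simp add: A_def powr_mult)
    finally show ?thesis .
  qed
  define C where "C = tractability_const \<alpha> * A + 1"
  have "tractability_bound \<alpha> C \<tau> 2"
    unfolding tractability_bound_def
  proof (intro allI impI)
    fix \<epsilon> :: real and d :: nat
    assume \<epsilon>: "0 < \<epsilon>" "\<epsilon> < 1" and d: "1 \<le> d"
    define X where "X = tractability_const \<alpha> * real d powr m * ln (real d + 1) powr s * \<epsilon> powr (- 2)"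
    have X0: "0 \<le> X" using C0 by (simp add: X_def)
    have "ereal_of_enat (inv_disc \<alpha> \<epsilon> d) \<le> ereal_of_enat (enat (nat \<lceil>X\<rceil>))"
      using inv_disc_bound[OF \<alpha> d \<epsilon>(1)] unfolding X_def m_def s_def ereal_of_enat_le_iff .
    also have "\<dots> \<le> ereal (X + 1)" using X0 by simp
    also have "X + 1 \<le> C * real d powr \<tau> * \<epsilon> powr (- 2)"
    proof -
      have "X \<le> tractability_const \<alpha> * real d powr m * (A * real d powr (\<tau> - m)) * \<epsilon> powr (- 2)"
        unfolding X_def using C0 ln_le[OF d] by (intro mult_right_mono mult_left_mono) auto
      also have "\<dots> = tractability_const \<alpha> * A * (real d powr m * real d powr (\<tau> - m)) * \<epsilon> powr (- 2)"
        by simp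
      also have "real d powr m * real d powr (\<tau> - m) = real d powr \<tau>" by (simp flip: powr_add)
      finally have "X \<le> tractability_const \<alpha> * A * real d powr \<tau> * \<epsilon> powr (- 2)" .
      moreover have "1 * 1 \<le> real d powr \<tau> * \<epsilon> powr (- 2)"
      proof (intro mult_mono)
        show "1 \<le> real d powr \<tau>" using d \<tau> by (intro ge_one_powr_ge_zero) auto
        show "1 \<le> \<epsilon> powr (- 2)" using \<epsilon> powr_mono'[of "- 2" 0 \<epsilon>] by simp
      qed auto
      ultimately show ?thesis by (simp add: C_def algebra_simps)
    qed
    finally show "ereal_of_enat (inv_disc \<alpha> \<epsilon> d) \<le> ereal (C * real d powr \<tau> * \<epsilon> powr (- 2))"
      by simp
  qed
  moreover have "0 < C" using C0 A by (simp add: C_def add_pos_pos)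
  ultimately show ?thesis by blast
qed

theorem theorem2:
  fixes \<alpha> :: real
  assumes "\<alpha> \<ge> 1"
  shows "(\<forall>(\<epsilon>::real) (d::nat). 0 < \<epsilon> \<longrightarrow> \<epsilon> < 1 \<longrightarrow> d \<ge> 1 \<longrightarrow>
           inv_disc \<alpha> \<epsilon> d \<le>
             enat (nat \<lceil>tractability_const \<alpha> * real d powr max 1 (2 / \<alpha>)
                        * ln (real d + 1) powr (2 / \<alpha>) * \<epsilon> powr (- 2)\<rceil>))
         \<and> polynomially_tractable \<alpha>
         \<and> d_exponent \<alpha> \<le> ereal (max 1 (2 / \<alpha>))"
proof (intro conjI allI impI)
  show "inv_disc \<alpha> \<epsilon> d \<le> enat (nat \<lceil>tractability_const \<alpha> * real d powr max 1 (2 / \<alpha>)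
                        * ln (real d + 1) powr (2 / \<alpha>) * \<epsilon> powr (- 2)\<rceil>)"
    if "0 < \<epsilon>" "d \<ge> 1" for \<epsilon> :: real and d :: nat
    using inv_disc_bound[OF assms that(2,1)] .
  obtain C where "C > 0" "tractability_bound \<alpha> C (max 1 (2 / \<alpha>) + 1) 2"
    using tractability_bound_above_exponent[OF assms, of "max 1 (2 / \<alpha>) + 1"] by auto
  then show "polynomially_tractable \<alpha>"
    unfolding polynomially_tractable_def
    by (intro exI[of _ C] exI[of _ "max 1 (2 / \<alpha>) + 1"] exI[of _ 2] conjI) (auto simp: max_def)
  show "d_exponent \<alpha> \<le> ereal (max 1 (2 / \<alpha>))"
  proof (rule ereal_le_epsilon2)
    fix \<delta> :: real assume \<delta>: "0 < \<delta>"
    define \<tau> where "\<tau> = max 1 (2 / \<alpha>) + \<delta>"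
    have "0 < \<tau>" using \<delta> by (simp add: \<tau>_def max_def add_pos_pos)
    moreover have "\<exists>C>0. \<exists>\<sigma>>0. tractability_bound \<alpha> C \<tau> \<sigma>"
      using tractability_bound_above_exponent[OF assms, of \<tau>] \<delta>
      by (metis \<tau>_def less_add_same_cancel1 zero_less_numeral)
    ultimately have "d_exponent \<alpha> \<le> ereal \<tau>"
      unfolding d_exponent_def by (intro Inf_lower) auto
    then show "d_exponent \<alpha> \<le> ereal (max 1 (2 / \<alpha>)) + ereal \<delta>" by (simp only: \<tau>_def plus_ereal.simps)
  qed
qed

end
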